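(* Let $\nu^{\boldsymbol\mu}=(\nu^{\mu_1},\dots,\nu^{\mu_K})$ be a bandit model whose arms belong to a one-parameter canonical exponential family, and let $c\ge7$. Consider the two index policies which draw each arm once and then, for $t\ge K$, select $A_{t+1}$ as an arm maximizing over $a$ respectively the index $$u_a^{+}(t)=\sup\Big\{q\in J:\ N_a(t)\,d(\hat\mu_a(t),q)\le\log\Big(\frac{t\log^c t}{N_a(t)}\Big)\Big\}\qquad(\text{kl-UCB}^+),$$ or, for a known horizon $T$, the index $$u_a^{H,+}(t)=\sup\Big\{q\in J:\ N_a(t)\,d(\hat\mu_a(t),q)\le\log\Big(\frac{T\log^c T}{N_a(t)}\Big)\Big\}\qquad(\text{kl-UCB-H}^+).$$ Write $\mu^*=\max_a\mu_a$. Then each of these two policies satisfies, for every $\varepsilon>0$ and every arm $a$ with $\mu_a<\mu^*$, $$\mathbb E[N_a(T)]\le\frac{1+\varepsilon}{d(\mu_a,\mu^* )}\log(T)+O_\varepsilon\big(\sqrt{\log T}\big)\qquad(T\to\infty).$$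
   Context: Exponential family: $\Theta=(\theta^-,\theta^+)\subseteq\mathbb R$ is an open interval, $\xi$ a reference measure on $\mathbb R$, and for $\theta\in\Theta$ the distribution $\nu_\theta$ has density $f_\theta(x)=\exp(\theta x-b(\theta))$ with respect to $\xi$, where $b$ is twice differentiable and convex. The mean of $\nu_\theta$ is $\dot b(\theta)$ and its variance is $\ddot b(\theta)>0$, so $\dot b$ is one-to-one from $\Theta$ onto the open interval $J=\dot b(\Theta)$. For $\mu\in J$, $\nu^\mu:=\nu_{\dot b^{-1}(\mu)}$, and $d(\mu,\mu')=\mathrm{KL}(\nu^\mu,\nu^{\mu'})$ for $\mu,\mu'\in J$. Since an empirical mean may fall outside $J$, $d$ is extended to $x\in\mathbb R$, $q\in J$ by $d(x,q)=\sup_{\lambda\in\Theta}\{(\lambda-\dot b^{-1}(q))x-b(\lambda)+b(\dot b^{-1}(q))\}\in[0,\infty]$, which agrees with the Kullback-Leibler divergence when $x\in J$. If the set in the definition of an index is empty, the index is set to $\hat\mu_a(t)$. Bandit model: there are $K\ge2$ arms with means $\mu_1,\dots,\mu_K\in J$; the successive rewards $(Y_{a,s})_{s\ge1}$ of arm $a$ are i.i.d. with law $\nu^{\mu_a}$, independent across arms. At round $t$ the policy chooses $A_t\in\{1,\dots,K\}$ from past observations and observes $Y_{A_t,N_{A_t}(t)}$, where $N_a(t)=\sum_{s=1}^t\mathbf 1(A_s=a)$. The empirical mean is $\hat\mu_a(t)=\frac1{N_a(t)}\sum_{k=1}^{N_a(t)}Y_{a,k}$. Ties in the argmax are broken arbitrarily.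 For kl-UCB-H$^+$ the policy depends on $T$, and $\mathbb E[N_a(T)]$ refers to the policy run with that same horizon $T$. *)

theory Defs
  imports "HOL-Probability.Probability" "HOL-Library.Landau_Symbols"
begin

definition mean_space :: "real set \<Rightarrow> (real \<Rightarrow> real) \<Rightarrow> real set" where
  "mean_space \<Theta> b = deriv b ` \<Theta>"

definition mean_param :: "real set \<Rightarrow> (real \<Rightarrow> real) \<Rightarrow> real \<Rightarrow> real" where
  "mean_param \<Theta> b \<mu> = the_inv_into \<Theta> (deriv b) \<mu>"

definition expfam :: "real measure \<Rightarrow> (real \<Rightarrow> real) \<Rightarrow> real \<Rightarrow> real measure" where
  "expfam \<xi> b \<theta> = density \<xi> (\<lambda>x. ennreal (exp (\<theta> * x - b \<theta>)))"

definition expfam_mean ::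
    "real measure \<Rightarrow> real set \<Rightarrow> (real \<Rightarrow> real) \<Rightarrow> real \<Rightarrow> real measure" where
  "expfam_mean \<xi> \<Theta> b \<mu> = expfam \<xi> b (mean_param \<Theta> b \<mu>)"

(* The library's KL_divergence takes the reference measure first: it integrates with respect to
   its second measure argument, so the arguments are swapped.  Base exp 1 gives natural logarithms. *)
definition kl_mean ::
    "real measure \<Rightarrow> real set \<Rightarrow> (real \<Rightarrow> real) \<Rightarrow> real \<Rightarrow> real \<Rightarrow> real" where
  "kl_mean \<xi> \<Theta> b \<mu> \<mu>' =
     KL_divergence (exp 1) (expfam_mean \<xi> \<Theta> b \<mu>') (expfam_mean \<xi> \<Theta> b \<mu>)"

(* Extension of kl_mean to a first argument outside the mean space; it may be infinite there. *)
definition kl_ext :: "real set \<Rightarrow> (real \<Rightarrow> real) \<Rightarrow> real \<Rightarrow> real \<Rightarrow> ereal" where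
  "kl_ext \<Theta> b x q =
     (SUP \<eta>\<in>\<Theta>. ereal ((\<eta> - mean_param \<Theta> b q) * x - b \<eta> + b (mean_param \<Theta> b q)))"

(* The mean of expfam \<xi> b \<theta> being deriv b \<theta>, and its variance being deriv (deriv b) \<theta>, follow from
   these axioms and are not assumed. *)
locale exponential_family =
  fixes \<Theta> :: "real set" and \<xi> :: "real measure" and b :: "real \<Rightarrow> real"
  assumes open_interval: "\<exists>l u. l < u \<and> \<Theta> = einterval l u"
    and sets_xi: "sets \<xi> = sets borel"
    and prob_space_expfam: "\<And>\<theta>. \<theta> \<in> \<Theta> \<Longrightarrow> prob_space (expfam \<xi> b \<theta>)"
    and b_differentiable: "\<And>\<theta>. \<theta> \<in> \<Theta> \<Longrightarrow> b differentiable (at \<theta>)"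
    and b_twice_differentiable: "\<And>\<theta>. \<theta> \<in> \<Theta> \<Longrightarrow> deriv b differentiable (at \<theta>)"
    and b_convex: "convex_on \<Theta> b"
    and deriv2_b_pos: "\<And>\<theta>. \<theta> \<in> \<Theta> \<Longrightarrow> deriv (deriv b) \<theta> > 0"

(* Arms are 1..K, and Y a s is the s-th reward of arm a (s \<ge> 1).  U is the internal randomization of
   the player, which a policy may use to break ties; it is jointly independent of all rewards and
   otherwise arbitrary (constant for deterministic tie-breaking).  In the independence assumption
   U has index None. *)
locale expfam_bandit =
  exponential_family \<Theta> \<xi> b + prob_space M
  for \<Theta> :: "real set" and \<xi> :: "real measure" and b :: "real \<Rightarrow> real" and M :: "'w measure" +
  fixes K :: nat and \<mu> :: "nat \<Rightarrow> real" and Y :: "nat \<Rightarrow> nat \<Rightarrow> 'w \<Rightarrow> real" and U :: "'w \<Rightarrow> real"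
  assumes K_ge_2: "K \<ge> 2"
    and means: "\<And>a. a \<in> {1..K} \<Longrightarrow> \<mu> a \<in> mean_space \<Theta> b"
    and reward_law:
      "\<And>a s. a \<in> {1..K} \<Longrightarrow> s \<ge> 1 \<Longrightarrow> distr M borel (Y a s) = expfam_mean \<xi> \<Theta> b (\<mu> a)"
    and independence:
      "indep_vars (\<lambda>_. borel) (\<lambda>i. case i of None \<Rightarrow> U | Some (a, s) \<Rightarrow> Y a s)
         (insert None (Some ` ({1..K} \<times> {1..})))"

(* A t \<omega> is the arm chosen at round t \<ge> 1. *)
definition pulls :: "(nat \<Rightarrow> 'w \<Rightarrow> nat) \<Rightarrow> nat \<Rightarrow> nat \<Rightarrow> 'w \<Rightarrow> nat" where
  "pulls A a t \<omega> = (\<Sum>s=1..t. of_bool (A s \<omega> = a))"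

definition emp_mean ::
    "(nat \<Rightarrow> nat \<Rightarrow> 'w \<Rightarrow> real) \<Rightarrow> (nat \<Rightarrow> 'w \<Rightarrow> nat) \<Rightarrow> nat \<Rightarrow> nat \<Rightarrow> 'w \<Rightarrow> real" where
  "emp_mean Y A a t \<omega> = (\<Sum>k=1..pulls A a t \<omega>. Y a k \<omega>) / real (pulls A a t \<omega>)"

definition history ::
    "(nat \<Rightarrow> nat \<Rightarrow> 'w \<Rightarrow> real) \<Rightarrow> (nat \<Rightarrow> 'w \<Rightarrow> nat) \<Rightarrow> nat \<Rightarrow> 'w \<Rightarrow> nat \<Rightarrow> nat \<times> real" where
  "history Y A t \<omega> = (\<lambda>s\<in>{1..t}. (A s \<omega>, Y (A s \<omega>) (pulls A (A s \<omega>) s \<omega>) \<omega>))"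

(* Each choice is a measurable function of the observations made so far and of U. *)
definition bandit_policy ::
    "'w measure \<Rightarrow> nat \<Rightarrow> (nat \<Rightarrow> nat \<Rightarrow> 'w \<Rightarrow> real) \<Rightarrow> ('w \<Rightarrow> real) \<Rightarrow> (nat \<Rightarrow> 'w \<Rightarrow> nat) \<Rightarrow> bool" where
  "bandit_policy M K Y U A \<longleftrightarrow>
     (\<forall>t. \<exists>\<pi> \<in> (borel \<Otimes>\<^sub>M (\<Pi>\<^sub>M s\<in>{1..t}. count_space UNIV \<Otimes>\<^sub>M borel)) \<rightarrow>\<^sub>M count_space {1..K}.
        \<forall>\<omega>\<in>space M. A (Suc t) \<omega> = \<pi> (U \<omega>, history Y A t \<omega>))"

(* The supremum is taken in the extended reals because the mean space may be unbounded. *)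
definition kl_ucb_index ::
    "real set \<Rightarrow> (real \<Rightarrow> real) \<Rightarrow> real \<Rightarrow> nat \<Rightarrow> real \<Rightarrow> ereal" where
  "kl_ucb_index \<Theta> b m n g =
     (let S = {q \<in> mean_space \<Theta> b. ereal (real n) * kl_ext \<Theta> b m q \<le> ereal (ln (g / real n))}
      in if S = {} then ereal m else Sup (ereal ` S))"

(* Index policy whose index at time t has exploration level ln (g t / N_a(t)).  Any choice of the
   maximizing arm is admitted, as is any order of the initial K draws. *)
definition kl_ucb_policy ::
    "real set \<Rightarrow> (real \<Rightarrow> real) \<Rightarrow> 'w measure \<Rightarrow> nat \<Rightarrow> (nat \<Rightarrow> nat \<Rightarrow> 'w \<Rightarrow> real) \<Rightarrow> ('w \<Rightarrow> real) \<Rightarrow>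
     (nat \<Rightarrow> real) \<Rightarrow> (nat \<Rightarrow> 'w \<Rightarrow> nat) \<Rightarrow> bool" where
  "kl_ucb_policy \<Theta> b M K Y U g A \<longleftrightarrow>
     bandit_policy M K Y U A \<and>
     (\<forall>\<omega>\<in>space M.
        bij_betw (\<lambda>t. A t \<omega>) {1..K} {1..K} \<and>
        (\<forall>t\<ge>K. is_arg_max
            (\<lambda>a. kl_ucb_index \<Theta> b (emp_mean Y A a t \<omega>) (pulls A a t \<omega>) (g t))
            (\<lambda>a. a \<in> {1..K}) (A (Suc t) \<omega>)))"

definition kl_ucb_plus ::
    "real set \<Rightarrow> (real \<Rightarrow> real) \<Rightarrow> 'w measure \<Rightarrow> nat \<Rightarrow> (nat \<Rightarrow> nat \<Rightarrow> 'w \<Rightarrow> real) \<Rightarrow> ('w \<Rightarrow> real) \<Rightarrow>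
     real \<Rightarrow> (nat \<Rightarrow> 'w \<Rightarrow> nat) \<Rightarrow> bool" where
  "kl_ucb_plus \<Theta> b M K Y U c A \<longleftrightarrow>
     kl_ucb_policy \<Theta> b M K Y U (\<lambda>t. real t * ln (real t) powr c) A"

definition kl_ucb_H_plus ::
    "real set \<Rightarrow> (real \<Rightarrow> real) \<Rightarrow> 'w measure \<Rightarrow> nat \<Rightarrow> (nat \<Rightarrow> nat \<Rightarrow> 'w \<Rightarrow> real) \<Rightarrow> ('w \<Rightarrow> real) \<Rightarrow>
     real \<Rightarrow> nat \<Rightarrow> (nat \<Rightarrow> 'w \<Rightarrow> nat) \<Rightarrow> bool" where
  "kl_ucb_H_plus \<Theta> b M K Y U c T A \<longleftrightarrow>
     kl_ucb_policy \<Theta> b M K Y U (\<lambda>_. real T * ln (real T) powr c) A"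

end

theory Submission
  imports Defs "HOL-Real_Asymp.Real_Asymp"
begin

text \<open>Write \<open>\<theta>\<^sub>a < \<theta>\<^sub>s\<close> for the natural parameters of the suboptimal and the optimal arm and fix
  \<open>\<theta>\<^sub>a < \<theta>\<^sub>r < \<theta>' < \<theta>\<^sub>q < \<theta>\<^sub>s\<close>. If the suboptimal arm is drawn, then either the index of the optimal arm
  is below the mean \<open>q\<close> of \<open>\<theta>\<^sub>q\<close>, or the index of the suboptimal arm is at least \<open>q\<close>. In the first
  case the optimal arm has an empirical mean below \<open>q\<close> and an exploration deficit; thanks to the slack
  between \<open>\<theta>\<^sub>q\<close> and \<open>\<theta>\<^sub>s\<close> this has probability at most \<open>n exp (- n \<kappa>) / g t\<close> when the optimal arm has
  been drawn \<open>n\<close> times, which is summable in \<open>n\<close>, and \<open>1 / (t ln\<^sup>c t)\<close> is summable in \<open>t\<close>. In the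
  second case, after \<open>n\<close> draws, either the empirical mean exceeds the mean of \<open>\<theta>\<^sub>r\<close>, which is
  exponentially unlikely in \<open>n\<close>, or \<open>n \<Delta> \<le> ln (g T)\<close>, where \<open>\<Delta>\<close> tends to the Kullback-Leibler
  divergence as \<open>\<theta>' \<rightarrow> \<theta>\<^sub>s\<close> and \<open>\<theta>\<^sub>r \<rightarrow> \<theta>\<^sub>a\<close>. All error terms are bounded or of order \<open>ln (ln T)\<close>, so
  they are absorbed by \<open>\<epsilon>\<close>.\<close>

text \<open>The logarithm of the density of parameter \<open>\<eta>\<close> with respect to parameter \<open>\<theta>\<close>.\<close>

definition llr :: "(real \<Rightarrow> real) \<Rightarrow> real \<Rightarrow> real \<Rightarrow> real \<Rightarrow> real" where
  "llr b \<theta> \<eta> x = (\<eta> - \<theta>) * x - b \<eta> + b \<theta>"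

section \<open>Convexity of the cumulant function and monotonicity of the likelihood ratio\<close>

context exponential_family
begin

lemma Theta_between: "\<lbrakk>x \<in> \<Theta>; y \<in> \<Theta>; x \<le> z; z \<le> y\<rbrakk> \<Longrightarrow> z \<in> \<Theta>"
proof -
  assume *: "x \<in> \<Theta>" "y \<in> \<Theta>" "x \<le> z" "z \<le> y"
  obtain l u where "\<Theta> = einterval l u" using open_interval by blast
  moreover have "ereal x \<le> ereal z" "ereal z \<le> ereal y" using * by simp_all
  ultimately show ?thesis
    using * by (auto simp only: einterval_iff intro: less_le_trans le_less_trans)
qed

lemma open_Theta: "open \<Theta>"
  using open_interval by auto

lemma DERIV_b: "\<theta> \<in> \<Theta> \<Longrightarrow> (b has_real_derivative deriv b \<theta>) (at \<theta>)"
  using b_differentiable by (simp add: DERIV_deriv_iff_real_differentiable)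

lemma deriv_b_less:
  assumes "\<theta> \<in> \<Theta>" "\<theta>' \<in> \<Theta>" "\<theta> < \<theta>'"
  shows "deriv b \<theta> < deriv b \<theta>'"
proof (rule DERIV_pos_imp_increasing[OF assms(3)])
  fix x assume "\<theta> \<le> x" "x \<le> \<theta>'"
  then have "x \<in> \<Theta>" using assms Theta_between by blast
  then show "\<exists>y. (deriv b has_real_derivative y) (at x) \<and> 0 < y"
    using b_twice_differentiable deriv2_b_pos DERIV_deriv_iff_real_differentiable by blast
qed

lemma inj_deriv_b: "inj_on (deriv b) \<Theta>"
  by (rule linorder_inj_onI) (use deriv_b_less in \<open>auto simp: less_le\<close>)

lemma deriv_b_less_iff:
  "\<theta> \<in> \<Theta> \<Longrightarrow> \<theta>' \<in> \<Theta> \<Longrightarrow> deriv b \<theta> < deriv b \<theta>' \<longleftrightarrow> \<theta> < \<theta>'"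
  using deriv_b_less by (metis less_irrefl linorder_less_linear order_less_trans)

lemma mean_param_deriv_b [simp]: "\<theta> \<in> \<Theta> \<Longrightarrow> mean_param \<Theta> b (deriv b \<theta>) = \<theta>"
  by (simp add: mean_param_def the_inv_into_f_f inj_deriv_b)

lemma mean_spaceE:
  assumes "q \<in> mean_space \<Theta> b"
  obtains \<theta> where "\<theta> \<in> \<Theta>" "q = deriv b \<theta>"
  using assms by (auto simp: mean_space_def)

text \<open>Strictness is what later makes the divergence between distinct parameters positive. It
  comes from the mean value theorem and the strict growth of \<open>deriv b\<close>.\<close>

lemma above_tangent:
  assumes "\<theta> \<in> \<Theta>" "\<theta>' \<in> \<Theta>" "\<theta> \<noteq> \<theta>'"
  shows "b \<theta> + deriv b \<theta> * (\<theta>' - \<theta>) < b \<theta>'"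
proof (cases "\<theta> < \<theta>'")
  case True
  then obtain z where z: "\<theta> < z" "z < \<theta>'" "b \<theta>' - b \<theta> = (\<theta>' - \<theta>) * deriv b z"
    using MVT2[OF True, of b "deriv b"] DERIV_b assms Theta_between by blast
  have "deriv b \<theta> < deriv b z"
    using deriv_b_less z assms Theta_between by (meson less_imp_le)
  then have "(\<theta>' - \<theta>) * deriv b \<theta> < (\<theta>' - \<theta>) * deriv b z"
    using True by simp
  then show ?thesis using z by (simp add: algebra_simps)
next
  case False
  then have less: "\<theta>' < \<theta>" using assms by simp
  then obtain z where z: "\<theta>' < z" "z < \<theta>" "b \<theta> - b \<theta>' = (\<theta> - \<theta>') * deriv b z"
    using MVT2[OF less, of b "deriv b"] DERIV_b assms Theta_between by blast
  have "deriv b z < deriv b \<theta>"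
    using deriv_b_less z assms Theta_between by (meson less_imp_le)
  then have "(\<theta> - \<theta>') * deriv b z < (\<theta> - \<theta>') * deriv b \<theta>"
    using less by simp
  then show ?thesis using z by (simp add: algebra_simps)
qed

lemma above_tangent_le:
  "\<theta> \<in> \<Theta> \<Longrightarrow> \<theta>' \<in> \<Theta> \<Longrightarrow> b \<theta> + deriv b \<theta> * (\<theta>' - \<theta>) \<le> b \<theta>'"
  using above_tangent by (cases "\<theta> = \<theta>'") (auto intro: less_imp_le)

text \<open>The tangent to \<open>b\<close> at \<eta> lies strictly below \<open>b\<close> at
  \<theta>. By \<open>kl_mean_deriv_b\<close> the quantity is a Kullback-Leibler divergence.\<close>

lemma llr_deriv_b_pos:
  "\<theta> \<in> \<Theta> \<Longrightarrow> \<eta> \<in> \<Theta> \<Longrightarrow> \<theta> \<noteq> \<eta> \<Longrightarrow> 0 < llr b \<theta> \<eta> (deriv b \<eta>)"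
  using above_tangent[of \<eta> \<theta>] by (simp add: llr_def algebra_simps)

text \<open>The difference of the two sides does not involve \<eta>: it is
  \<open>b \<theta>' - b \<theta> - (\<theta>' - \<theta>) * x\<close>, and \<open>x\<close> is at
  most the slope of the tangent at \<theta>. So every single term of the supremum in
  \<open>kl_ext\<close> grows as \<theta> moves right, away from \<open>x\<close>.\<close>

lemma llr_le_right:
  assumes "\<theta> \<in> \<Theta>" "\<theta>' \<in> \<Theta>" "\<theta> \<le> \<theta>'" "x \<le> deriv b \<theta>"
  shows "llr b \<theta> \<eta> x \<le> llr b \<theta>' \<eta> x"
proof -
  have "0 \<le> (deriv b \<theta> - x) * (\<theta>' - \<theta>)" using assms by simp
  then show ?thesis
    using above_tangent_le[OF assms(1,2)] by (simp add: llr_def algebra_simps)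
qed

lemma llr_le_left:
  assumes "\<theta> \<in> \<Theta>" "\<theta>' \<in> \<Theta>" "\<theta>' \<le> \<theta>" "deriv b \<theta> \<le> x"
  shows "llr b \<theta> \<eta> x \<le> llr b \<theta>' \<eta> x"
proof -
  have "0 \<le> (x - deriv b \<theta>) * (\<theta> - \<theta>')" using assms by simp
  then show ?thesis
    using above_tangent_le[OF assms(1,2)] by (simp add: llr_def algebra_simps)
qed

section \<open>The divergence constraint and the index\<close>

lemma kl_ext_deriv_b:
  "\<theta> \<in> \<Theta> \<Longrightarrow> kl_ext \<Theta> b x (deriv b \<theta>) = (SUP \<eta>\<in>\<Theta>. ereal (llr b \<theta> \<eta> x))"
  by (simp add: kl_ext_def llr_def)

text \<open>Replaces the possibly infinite divergence by a family of real inequalities, to which the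
  monotonicity of \<open>llr\<close> applies term by term.\<close>

lemma times_kl_ext_le_iff:
  assumes "\<theta> \<in> \<Theta>" "0 < n"
  shows "ereal (real n) * kl_ext \<Theta> b x (deriv b \<theta>) \<le> ereal y
    \<longleftrightarrow> (\<forall>\<eta>\<in>\<Theta>. real n * llr b \<theta> \<eta> x \<le> y)"
proof -
  have "ereal (real n) * kl_ext \<Theta> b x (deriv b \<theta>) \<le> ereal y
     \<longleftrightarrow> kl_ext \<Theta> b x (deriv b \<theta>) \<le> ereal (y / real n)"
    using assms by (cases "kl_ext \<Theta> b x (deriv b \<theta>)") (auto simp: field_simps)
  also have "\<dots> \<longleftrightarrow> (\<forall>\<eta>\<in>\<Theta>. real n * llr b \<theta> \<eta> x \<le> y)"
    using assms by (auto simp: kl_ext_deriv_b SUP_le_iff field_simps)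
  finally show ?thesis .
qed

lemma index_lessD:
  assumes \<theta>: "\<theta> \<in> \<Theta>" and n: "0 < n"
    and less: "kl_ucb_index \<Theta> b m n g < ereal (deriv b \<theta>)"
  shows "m < deriv b \<theta>" "\<exists>\<eta>\<in>\<Theta>. ln (g / real n) < real n * llr b \<theta> \<eta> m"
proof -
  define S where
    "S = {q \<in> mean_space \<Theta> b. ereal (real n) * kl_ext \<Theta> b m q \<le> ereal (ln (g / real n))}"
  have index: "kl_ucb_index \<Theta> b m n g = (if S = {} then ereal m else Sup (ereal ` S))"
    by (simp only: kl_ucb_index_def S_def Let_def)
  have S_iff: "deriv b \<eta> \<in> S \<longleftrightarrow> (\<forall>\<zeta>\<in>\<Theta>. real n * llr b \<eta> \<zeta> m \<le> ln (g / real n))"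
    if "\<eta> \<in> \<Theta>" for \<eta>
    using that n by (auto simp: S_def times_kl_ext_le_iff mean_space_def)
  have notin: "deriv b \<theta> \<notin> S"
  proof
    assume "deriv b \<theta> \<in> S"
    then have "ereal (deriv b \<theta>) \<le> kl_ucb_index \<Theta> b m n g"
      unfolding index by (auto intro: Sup_upper)
    with less show False by simp
  qed
  then show "\<exists>\<eta>\<in>\<Theta>. ln (g / real n) < real n * llr b \<theta> \<eta> m"
    using S_iff[OF \<theta>] by (auto simp: not_le)
  show "m < deriv b \<theta>"
  proof (rule ccontr)
    assume m: "\<not> m < deriv b \<theta>"
    show False
    proof (cases "S = {}")
      case True
      with less index m show False by simp
    next
      case False
      then obtain q where q: "q \<in> S" by blast
      then obtain \<eta> where \<eta>: "\<eta> \<in> \<Theta>" "q = deriv b \<eta>"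
        by (auto simp: S_def elim: mean_spaceE)
      have "ereal q \<le> kl_ucb_index \<Theta> b m n g"
        using q by (auto simp: index intro: Sup_upper)
      from this less have "ereal q < ereal (deriv b \<theta>)" by (rule le_less_trans)
      then have "\<eta> < \<theta>" using \<eta> \<theta> by (simp add: deriv_b_less_iff)
      then have "llr b \<theta> \<zeta> m \<le> llr b \<eta> \<zeta> m" for \<zeta>
        using llr_le_left[OF \<theta> \<eta>(1)] m by simp
      then have "real n * llr b \<theta> \<zeta> m \<le> real n * llr b \<eta> \<zeta> m" for \<zeta>
        by (simp add: mult_left_mono)
      with q \<eta> have "deriv b \<theta> \<in> S"
        using S_iff[OF \<eta>(1)] S_iff[OF \<theta>] order_trans by blast
      with notin show False ..
    qed
  qed
qed

lemma index_geD:
  assumes \<theta>: "\<theta> \<in> \<Theta>" "\<theta>' \<in> \<Theta>" "\<theta>' < \<theta>" and n: "0 < n"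
    and ge: "ereal (deriv b \<theta>) \<le> kl_ucb_index \<Theta> b m n g"
    and m: "m \<le> deriv b \<theta>'" and \<eta>: "\<eta> \<in> \<Theta>"
  shows "real n * llr b \<theta>' \<eta> m \<le> ln (g / real n)"
proof -
  define S where
    "S = {q \<in> mean_space \<Theta> b. ereal (real n) * kl_ext \<Theta> b m q \<le> ereal (ln (g / real n))}"
  have index: "kl_ucb_index \<Theta> b m n g = (if S = {} then ereal m else Sup (ereal ` S))"
    by (simp only: kl_ucb_index_def S_def Let_def)
  have less: "ereal (deriv b \<theta>') < kl_ucb_index \<Theta> b m n g"
    by (rule less_le_trans[OF _ ge]) (simp add: deriv_b_less[OF \<theta>(2,1,3)])
  with m index have "S \<noteq> {}" by auto
  with less index obtain q where q: "q \<in> S" "deriv b \<theta>' < q"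
    by (auto simp: less_Sup_iff)
  then obtain \<zeta> where \<zeta>: "\<zeta> \<in> \<Theta>" "q = deriv b \<zeta>"
    by (auto simp: S_def elim: mean_spaceE)
  then have "real n * llr b \<zeta> \<eta> m \<le> ln (g / real n)"
    using q n \<eta> by (auto simp: S_def times_kl_ext_le_iff)
  moreover have "llr b \<theta>' \<eta> m \<le> llr b \<zeta> \<eta> m"
    using llr_le_right[OF \<theta>(2) \<zeta>(1) _ m] q \<zeta> \<theta> by (auto simp: deriv_b_less_iff)
  ultimately show ?thesis
    using n by (meson mult_left_mono of_nat_0_le_iff order_trans)
qed

section \<open>Exponential moments, mean and Kullback-Leibler divergence\<close>

text \<open>Exponential tilting: up to a constant factor, the density at \<theta> times
  \<open>exp (l * x)\<close> is the density at \<open>\<theta> + l\<close>, whose total mass is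
  1.\<close>

lemma nn_integral_expfam_exp:
  assumes "\<theta> \<in> \<Theta>" "\<theta> + l \<in> \<Theta>"
  shows "(\<integral>\<^sup>+x. ennreal (exp (l * x)) \<partial>expfam \<xi> b \<theta>) = ennreal (exp (b (\<theta> + l) - b \<theta>))"
proof -
  note [measurable_cong] = sets_xi
  interpret E: prob_space "expfam \<xi> b (\<theta> + l)" using prob_space_expfam assms by blast
  have "(\<integral>\<^sup>+x. ennreal (exp (l * x)) \<partial>expfam \<xi> b \<theta>)
     = (\<integral>\<^sup>+x. ennreal (exp (\<theta> * x - b \<theta>)) * ennreal (exp (l * x)) \<partial>\<xi>)"
    unfolding expfam_def by (rule nn_integral_density) measurable
  also have "\<dots> = (\<integral>\<^sup>+x. ennreal (exp (b (\<theta> + l) - b \<theta>)) *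
      ennreal (exp ((\<theta> + l) * x - b (\<theta> + l))) \<partial>\<xi>)"
    by (intro nn_integral_cong)
       (simp add: ennreal_mult[symmetric] exp_add[symmetric] algebra_simps)
  also have "\<dots> = ennreal (exp (b (\<theta> + l) - b \<theta>)) *
      (\<integral>\<^sup>+x. ennreal (exp ((\<theta> + l) * x - b (\<theta> + l))) \<partial>\<xi>)"
    by (rule nn_integral_cmult) measurable
  also have "(\<integral>\<^sup>+x. ennreal (exp ((\<theta> + l) * x - b (\<theta> + l))) \<partial>\<xi>)
     = emeasure (expfam \<xi> b (\<theta> + l)) (space (expfam \<xi> b (\<theta> + l)))"
    unfolding expfam_def by (subst emeasure_density) (auto intro!: nn_integral_cong)
  finally show ?thesis by (simp add: E.emeasure_space_1)
qed

lemma sets_expfam [measurable_cong]: "sets (expfam \<xi> b \<theta>) = sets borel"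
  by (simp add: expfam_def sets_xi)

lemma integrable_expfam_exp:
  assumes "\<theta> \<in> \<Theta>" "\<theta> + l \<in> \<Theta>"
  shows "integrable (expfam \<xi> b \<theta>) (\<lambda>x. exp (l * x))"
    and "(\<integral>x. exp (l * x) \<partial>expfam \<xi> b \<theta>) = exp (b (\<theta> + l) - b \<theta>)"
proof -
  note nn = nn_integral_expfam_exp[OF assms]
  show "integrable (expfam \<xi> b \<theta>) (\<lambda>x. exp (l * x))"
    by (rule integrableI_nonneg) (auto simp: nn)
  show "(\<integral>x. exp (l * x) \<partial>expfam \<xi> b \<theta>) = exp (b (\<theta> + l) - b \<theta>)"
    by (subst integral_eq_nn_integral) (auto simp: nn)
qed

text \<open>The derivative of the cumulant function is read off the tangent inequality
  \<open>1 + l x \<le> exp (l x)\<close>: after integration, both sides agree to first order at \<open>l = 0\<close>,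
  so no differentiation under the integral sign is needed.\<close>

lemma expfam_integrable_id_and_mean:
  assumes "\<theta> \<in> \<Theta>"
  shows "integrable (expfam \<xi> b \<theta>) (\<lambda>x. x)"
    and "(\<integral>x. x \<partial>expfam \<xi> b \<theta>) = deriv b \<theta>"
proof -
  interpret E: prob_space "expfam \<xi> b \<theta>" using prob_space_expfam assms by blast
  obtain e where e: "e > 0" "ball \<theta> e \<subseteq> \<Theta>"
    using open_Theta assms by (meson openE)
  have in_Theta: "\<theta> + l \<in> \<Theta>" if "\<bar>l\<bar> < e" for l
    using e that by (auto simp: ball_def dist_real_def)
  define h where "h = e / 2"
  have h: "h > 0" "\<theta> + h \<in> \<Theta>" "\<theta> + (-h) \<in> \<Theta>"
    using e in_Theta[of h] in_Theta[of "-h"] by (auto simp: h_def)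
  show int: "integrable (expfam \<xi> b \<theta>) (\<lambda>x. x)"
  proof (rule Bochner_Integration.integrable_bound)
    show "integrable (expfam \<xi> b \<theta>) (\<lambda>x. (exp (h * x) + exp ((-h) * x)) / h)"
      by (intro integrable_divide_zero Bochner_Integration.integrable_add
          integrable_expfam_exp assms h)
    \<comment> \<open>Both \<open>\<theta> + h\<close> and \<open>\<theta> - h\<close> lie in the
      open set \<Theta>, so the two exponentials are integrable and dominate the identity.\<close>
    have "\<bar>x\<bar> \<le> (exp (h * x) + exp (- h * x)) / h" for x :: real
    proof -
      have "h * x \<le> exp (h * x)" "- h * x \<le> exp (- h * x)"
        using exp_ge_add_one_self[of "h * x"] exp_ge_add_one_self[of "- h * x"] by linarith+
      moreover have "0 \<le> exp (h * x)" "0 \<le> exp (- h * x)" by simp_all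
      ultimately have "\<bar>h * x\<bar> \<le> exp (h * x) + exp (- h * x)" by linarith
      then show ?thesis using h by (simp add: field_simps abs_mult)
    qed
    then show "AE x in expfam \<xi> b \<theta>. norm x \<le> norm ((exp (h * x) + exp ((-h) * x)) / h)"
      using h by (intro AE_I2) simp
  qed measurable
  define m where "m = (\<integral>x. x \<partial>expfam \<xi> b \<theta>)"
  define f where "f l = exp (b (\<theta> + l) - b \<theta>) - 1 - l * m" for l
  have f_nonneg: "0 \<le> f l" if "\<bar>l\<bar> < e" for l
  proof -
    have "(\<integral>x. 1 + l * x \<partial>expfam \<xi> b \<theta>) \<le> (\<integral>x. exp (l * x) \<partial>expfam \<xi> b \<theta>)"
      using int by (intro integral_mono integrable_expfam_exp assms in_Theta that) auto
    also have "(\<integral>x. 1 + l * x \<partial>expfam \<xi> b \<theta>) = 1 + l * m"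
      using int by (simp add: m_def E.prob_space)
    finally show ?thesis
      by (simp add: f_def integrable_expfam_exp(2)[OF assms in_Theta[OF that]])
  qed
  have "(f has_real_derivative deriv b \<theta> - m) (at 0)"
  proof -
    have "((\<lambda>l. b (\<theta> + l)) has_real_derivative deriv b \<theta>) (at 0)"
      using DERIV_b[OF assms] DERIV_at_within_shift[of b "deriv b \<theta>" \<theta> 0 UNIV] by simp
    from this show ?thesis
      unfolding f_def by (auto intro!: derivative_eq_intros)
  qed
  \<comment> \<open>\<open>f\<close> is nonnegative near 0 and vanishes at 0, so 0 is a local
    minimum.\<close>
  then have "deriv b \<theta> - m = 0"
    by (rule DERIV_local_min[OF _ e(1)]) (use f_nonneg in \<open>auto simp: f_def\<close>)
  then show "(\<integral>x. x \<partial>expfam \<xi> b \<theta>) = deriv b \<theta>" by (simp add: m_def)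
qed

text \<open>The logarithm of the relative density is affine in \<open>x\<close>, so its integral
  under \<eta> is its value at the mean \<open>deriv b \<eta>\<close>.\<close>

lemma kl_mean_deriv_b:
  assumes "\<theta> \<in> \<Theta>" "\<eta> \<in> \<Theta>"
  shows "kl_mean \<xi> \<Theta> b (deriv b \<eta>) (deriv b \<theta>) = llr b \<theta> \<eta> (deriv b \<eta>)"
proof -
  note [measurable_cong] = sets_xi
  let ?M = "expfam \<xi> b \<theta>" and ?f = "\<lambda>x. exp (llr b \<theta> \<eta> x)"
  interpret E: prob_space ?M using prob_space_expfam assms by blast
  interpret F: prob_space "expfam \<xi> b \<eta>" using prob_space_expfam assms by blast
  have [measurable]: "?f \<in> borel_measurable borel" "llr b \<theta> \<eta> \<in> borel_measurable borel"
    unfolding llr_def by measurable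
  have dens: "expfam \<xi> b \<eta> = density ?M (\<lambda>x. ennreal (?f x))"
    unfolding expfam_def
    by (subst density_density_eq)
      (auto intro!: density_cong simp: ennreal_mult[symmetric] exp_add[symmetric] llr_def algebra_simps)
  have "kl_mean \<xi> \<Theta> b (deriv b \<eta>) (deriv b \<theta>) = KL_divergence (exp 1) ?M (density ?M (\<lambda>x. ennreal (?f x)))"
    using assms by (simp add: kl_mean_def expfam_mean_def dens)
  also have "\<dots> = (\<integral>x. ?f x * log (exp 1) (?f x) \<partial>?M)"
    by (rule E.KL_density) auto
  also have "\<dots> = (\<integral>x. llr b \<theta> \<eta> x \<partial>density ?M (\<lambda>x. ennreal (?f x)))"
    by (subst integral_density) (auto simp: log_def)
  also have "\<dots> = (\<integral>x. (\<eta> - \<theta>) * x + (b \<theta> - b \<eta>) \<partial>expfam \<xi> b \<eta>)"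
    unfolding dens by (rule Bochner_Integration.integral_cong) (simp_all add: llr_def algebra_simps)
  also have "\<dots> = (\<eta> - \<theta>) * deriv b \<eta> + (b \<theta> - b \<eta>)"
    using expfam_integrable_id_and_mean[OF assms(2)] by (simp add: F.prob_space)
  finally show ?thesis by (simp add: llr_def)
qed

end


section \<open>Counting pulls, and independence of the rewards of one arm\<close>

text \<open>Indexed by a fixed number of draws instead of a round, so that it does not depend on the
  policy and deviation bounds for fixed sample sizes apply.\<close>

definition sample_mean :: "(nat \<Rightarrow> nat \<Rightarrow> 'w \<Rightarrow> real) \<Rightarrow> nat \<Rightarrow> nat \<Rightarrow> 'w \<Rightarrow> real" where
  "sample_mean Y a n \<omega> = (\<Sum>k=1..n. Y a k \<omega>) / real n"

lemma emp_mean_eq: "emp_mean Y A a t \<omega> = sample_mean Y a (pulls A a t \<omega>) \<omega>"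
  by (simp add: emp_mean_def sample_mean_def)

lemma pulls_Suc: "pulls A a (Suc t) \<omega> = pulls A a t \<omega> + of_bool (A (Suc t) \<omega> = a)"
  by (simp add: pulls_def)

lemma pulls_mono: "s \<le> t \<Longrightarrow> pulls A a s \<omega> \<le> pulls A a t \<omega>"
  unfolding pulls_def by (rule sum_mono2) auto

lemma pulls_le: "pulls A a t \<omega> \<le> t"
  by (induction t) (auto simp: pulls_Suc, simp add: pulls_def)

lemma pulls_initial:
  assumes "bij_betw (\<lambda>t. A t \<omega>) {1..K} {1..K}" "a \<in> {1..K}"
  shows "pulls A a K \<omega> = 1"
proof -
  have "pulls A a K \<omega> = (\<Sum>i\<in>{1..K}. of_bool (i = a))"
    unfolding pulls_def by (rule sum.reindex_bij_betw[OF assms(1)])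
  then show ?thesis using assms(2) by (simp add: of_bool_def)
qed

text \<open>Each pull increments the counter, so a property of the counter value is charged at most
  once per value.\<close>

lemma pulls_le_count:
  assumes "K \<le> T" "pulls A a K \<omega> = 1"
  shows "pulls A a T \<omega> \<le> 1
    + (\<Sum>t\<in>{K..<T}. of_bool (A (Suc t) \<omega> = a \<and> \<not> P (pulls A a t \<omega>)))
    + (\<Sum>n\<in>{1..<pulls A a T \<omega>}. of_bool (P n))"
  using assms(1)
proof (induction T rule: dec_induct)
  case base
  then show ?case using assms by simp
next
  case (step T)
  \<comment> \<open>Because of the initial draw the current counter value belongs to the range of
    the second sum once it is incremented.\<close>
  have "1 \<le> pulls A a T \<omega>"
    using pulls_mono[OF step(1), of A a \<omega>] assms(2) by simp
  then show ?case
    using step by (cases "A (Suc T) \<omega> = a"; cases "P (pulls A a T \<omega>)") (auto simp: pulls_Suc)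
qed

lemma (in prob_space) indep_vars_reindex:
  assumes inj: "inj_on f I" and indep: "indep_vars M' X (f ` I)"
  shows "indep_vars (\<lambda>i. M' (f i)) (\<lambda>i. X (f i)) I"
proof -
  let ?F = "\<lambda>i. {X i -` A \<inter> space M |A. A \<in> sets (M' i)}"
  have rv: "random_variable (M' (f i)) (X (f i))" if "i \<in> I" for i
    using indep that by (simp add: indep_vars_def2)
  have "indep_sets (\<lambda>i. ?F (f i)) I"
  proof (rule indep_setsI)
    show "?F (f i) \<subseteq> events" if "i \<in> I" for i
      using rv[OF that] by (auto intro: measurable_sets)
  next
    fix A J assume J: "J \<noteq> {}" "J \<subseteq> I" "finite J" and A: "\<forall>j\<in>J. A j \<in> ?F (f j)"
    let ?A = "\<lambda>i. A (the_inv_into J f i)"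
    have injJ: "inj_on f J" using inj J(2) by (rule inj_on_subset)
    have "prob (\<Inter>j\<in>f ` J. ?A j) = (\<Prod>j\<in>f ` J. prob (?A j))"
    proof (rule indep_setsD[of ?F "f ` I"])
      show "indep_sets ?F (f ` I)" using indep by (simp add: indep_vars_def2)
      show "\<forall>j\<in>f ` J. ?A j \<in> ?F j" using A injJ by (simp add: the_inv_into_f_f)
    qed (use J in auto)
    then show "prob (\<Inter>j\<in>J. A j) = (\<Prod>j\<in>J. prob (A j))"
      using injJ by (simp add: prod.reindex the_inv_into_f_f)
  qed
  with rv show ?thesis by (simp add: indep_vars_def2)
qed

section \<open>Deviation inequalities for the sample means\<close>

context expfam_bandit
begin

lemma reward_measurable [measurable]:
  assumes "a \<in> {1..K}" "s \<ge> 1"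
  shows "Y a s \<in> borel_measurable M"
proof -
  have "Some (a, s) \<in> insert None (Some ` ({1..K} \<times> {1..}))" using assms by auto
  then show ?thesis
    using independence unfolding indep_vars_def by fastforce
qed

lemma sample_mean_measurable [measurable]:
  "a \<in> {1..K} \<Longrightarrow> sample_mean Y a n \<in> borel_measurable M"
  unfolding sample_mean_def[abs_def]
  by (intro borel_measurable_divide borel_measurable_sum reward_measurable) auto

lemma indep_rewards:
  assumes "a \<in> {1..K}"
  shows "indep_vars (\<lambda>_. borel) (Y a) {1..n}"
proof -
  have "indep_vars (\<lambda>_. borel) (\<lambda>i. case i of None \<Rightarrow> U | Some (a, s) \<Rightarrow> Y a s)
      ((\<lambda>s. Some (a, s)) ` {1..n})"
    by (rule indep_vars_subset[OF independence]) (use assms in auto)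
  from indep_vars_reindex[OF _ this] show ?thesis
    by (simp add: inj_on_def)
qed

text \<open>The exponential of \<open>n\<close> times the ratio at the sample mean is the likelihood
  ratio of \<open>n\<close> draws, a product of independent factors of expectation 1 under the true
  parameter \<theta>; Markov's inequality concludes. As \<eta> may lie on either side of \<theta>,
  the bound serves upper and lower deviations alike.\<close>

lemma chernoff:
  assumes a: "a \<in> {1..K}" and \<theta>: "\<theta> \<in> \<Theta>" "\<mu> a = deriv b \<theta>" and \<eta>: "\<eta> \<in> \<Theta>" and n: "0 < n"
  shows "prob {\<omega> \<in> space M. v \<le> real n * llr b \<theta> \<eta> (sample_mean Y a n \<omega>)} \<le> exp (- v)"
proof -
  let ?Z = "\<lambda>k \<omega>. ennreal (exp ((\<eta> - \<theta>) * Y a k \<omega> - (b \<eta> - b \<theta>)))"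
  have meas: "k \<in> {1..n} \<Longrightarrow> Y a k \<in> borel_measurable M" for k
    using reward_measurable a by auto
  have [measurable]: "sample_mean Y a n \<in> borel_measurable M" using a by measurable
  have [measurable]: "llr b \<theta> \<eta> \<in> borel_measurable borel"
    unfolding llr_def by measurable
  have Z: "(\<integral>\<^sup>+\<omega>. ?Z k \<omega> \<partial>M) = 1" if "k \<in> {1..n}" for k
  proof -
    have [measurable]: "Y a k \<in> borel_measurable M" using meas that .
    have "(\<integral>\<^sup>+\<omega>. ?Z k \<omega> \<partial>M)
       = (\<integral>\<^sup>+x. ennreal (exp ((\<eta> - \<theta>) * x - (b \<eta> - b \<theta>))) \<partial>distr M borel (Y a k))"
      by (subst nn_integral_distr) auto
    also have "\<dots> = (\<integral>\<^sup>+x. ennreal (exp ((\<eta> - \<theta>) * x - (b \<eta> - b \<theta>))) \<partial>expfam \<xi> b \<theta>)"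
      using reward_law[of a k] a that \<theta> by (simp add: expfam_mean_def)
    also have "\<dots> = (\<integral>\<^sup>+x. ennreal (exp (- (b \<eta> - b \<theta>))) * ennreal (exp ((\<eta> - \<theta>) * x)) \<partial>expfam \<xi> b \<theta>)"
      by (intro nn_integral_cong) (simp add: ennreal_mult[symmetric] exp_add[symmetric])
    also have "\<dots> = ennreal (exp (- (b \<eta> - b \<theta>))) * (\<integral>\<^sup>+x. ennreal (exp ((\<eta> - \<theta>) * x)) \<partial>expfam \<xi> b \<theta>)"
      by (rule nn_integral_cmult) measurable
    also have "\<dots> = 1"
      using nn_integral_expfam_exp[of \<theta> "\<eta> - \<theta>"] \<theta> \<eta>
      by (simp add: ennreal_mult[symmetric] exp_add[symmetric])
    finally show ?thesis .
  qed
  have sum_eq: "real n * llr b \<theta> \<eta> (sample_mean Y a n \<omega>)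
      = (\<Sum>k=1..n. (\<eta> - \<theta>) * Y a k \<omega> - (b \<eta> - b \<theta>))" for \<omega>
  proof -
    have "real n * llr b \<theta> \<eta> (sample_mean Y a n \<omega>)
        = (\<eta> - \<theta>) * (real n * sample_mean Y a n \<omega>) - real n * (b \<eta> - b \<theta>)"
      by (simp add: llr_def algebra_simps)
    also have "real n * sample_mean Y a n \<omega> = (\<Sum>k=1..n. Y a k \<omega>)"
      using n by (simp add: sample_mean_def)
    finally show ?thesis by (simp add: sum_subtractf sum_distrib_left)
  qed
  have prod_eq: "ennreal (exp (real n * llr b \<theta> \<eta> (sample_mean Y a n \<omega>))) = (\<Prod>k\<in>{1..n}. ?Z k \<omega>)" for \<omega>
    unfolding sum_eq by (simp add: exp_sum prod_ennreal)
  have "emeasure M {\<omega> \<in> space M. v \<le> real n * llr b \<theta> \<eta> (sample_mean Y a n \<omega>)}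
     = (\<integral>\<^sup>+\<omega>. indicator {\<omega> \<in> space M. v \<le> real n * llr b \<theta> \<eta> (sample_mean Y a n \<omega>)} \<omega> \<partial>M)"
    by (rule nn_integral_indicator[symmetric]) measurable
  also have "\<dots> \<le> (\<integral>\<^sup>+\<omega>. ennreal (exp (- v)) * (\<Prod>k\<in>{1..n}. ?Z k \<omega>) \<partial>M)"
  proof (rule nn_integral_mono)
    fix \<omega>
    show "indicator {\<omega> \<in> space M. v \<le> real n * llr b \<theta> \<eta> (sample_mean Y a n \<omega>)} \<omega>
        \<le> ennreal (exp (- v)) * (\<Prod>k\<in>{1..n}. ?Z k \<omega>)"
      unfolding prod_eq[symmetric]
      by (auto simp: indicator_def ennreal_mult[symmetric] exp_add[symmetric])
  qed
  also have "\<dots> = ennreal (exp (- v)) * (\<integral>\<^sup>+\<omega>. (\<Prod>k\<in>{1..n}. ?Z k \<omega>) \<partial>M)"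
    using meas by (intro nn_integral_cmult borel_measurable_prod) auto
  also have "(\<integral>\<^sup>+\<omega>. (\<Prod>k\<in>{1..n}. ?Z k \<omega>) \<partial>M) = (\<Prod>k\<in>{1..n}. \<integral>\<^sup>+\<omega>. ?Z k \<omega> \<partial>M)"
  proof (rule indep_vars_nn_integral)
    show "indep_vars (\<lambda>_. borel) ?Z {1..n}"
      by (rule indep_vars_compose2[OF indep_rewards[OF a]]) measurable
  qed auto
  also have "\<dots> = 1" using Z by simp
  finally show ?thesis by (simp add: emeasure_eq_measure)
qed

text \<open>The union over \<open>\<eta>\<close> costs nothing: it is an open half-line, and every smaller closed
  half-line is controlled by a single \<open>\<eta>\<close>. Passing from the parameter \<open>\<theta>\<close> to the true parameter
  \<open>\<theta>\<^sub>s\<close> gains the factor that is exponentially small in \<open>n\<close>.\<close>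

lemma lower_deviation:
  fixes y :: real
  assumes i: "i \<in> {1..K}" and \<theta>s: "\<theta>\<^sub>s \<in> \<Theta>" "\<mu> i = deriv b \<theta>\<^sub>s"
    and \<theta>: "\<theta> \<in> \<Theta>" "\<theta> < \<theta>\<^sub>s" and n: "0 < n"
  defines "D \<equiv> {x. x < deriv b \<theta> \<and> (\<exists>\<eta>\<in>\<Theta>. y < real n * llr b \<theta> \<eta> x)}"
  shows "D \<in> sets borel"
    and "prob {\<omega> \<in> space M. sample_mean Y i n \<omega> \<in> D}
      \<le> exp (- (y + real n * llr b \<theta>\<^sub>s \<theta> (deriv b \<theta>)))"
proof -
  let ?\<kappa> = "llr b \<theta>\<^sub>s \<theta> (deriv b \<theta>)"
  let ?X = "sample_mean Y i n"
  have [measurable]: "?X \<in> borel_measurable M" using i by measurable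
  have D_eq: "D = {..<deriv b \<theta>} \<inter> (\<Union>\<eta>\<in>\<Theta>. {x. y < real n * llr b \<theta> \<eta> x})"
    by (auto simp: D_def)
  have "open D"
    unfolding D_eq llr_def
    by (intro open_Int open_UN ballI open_Collect_less continuous_intros)
  then show "D \<in> sets borel" by simp
  have half_line: "prob {\<omega> \<in> space M. ?X \<omega> \<le> x} \<le> exp (- (y + real n * ?\<kappa>))" if xD: "x \<in> D" for x
  proof -
    \<comment> \<open>A witness \<eta> right of \<theta> can be replaced by \<theta>: its ratio is
      at most \<open>llr b \<eta> \<eta> x\<close>, which is 0 like
      \<open>llr b \<theta> \<theta> x\<close>. With \<eta> \<le> \<theta> the ratio does not
      increase with the sample mean.\<close>
    have "\<exists>\<eta>\<in>\<Theta>. \<eta> \<le> \<theta> \<and> y < real n * llr b \<theta> \<eta> x"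
    proof -
      obtain \<eta> where \<eta>: "\<eta> \<in> \<Theta>" "y < real n * llr b \<theta> \<eta> x" "x < deriv b \<theta>"
        using xD by (auto simp: D_def)
      show ?thesis
      proof (cases "\<eta> \<le> \<theta>")
        case True
        then show ?thesis using \<eta> by blast
      next
        case False
        then have "llr b \<theta> \<eta> x \<le> llr b \<eta> \<eta> x"
          using llr_le_right[of \<theta> \<eta> x \<eta>] \<theta> \<eta> by simp
        also have "\<dots> = llr b \<theta> \<theta> x" by (simp add: llr_def)
        finally have "real n * llr b \<theta> \<eta> x \<le> real n * llr b \<theta> \<theta> x"
          by (simp add: mult_left_mono)
        then show ?thesis using \<eta> \<theta> by (intro bexI[of _ \<theta>]) auto
      qed
    qed
    then obtain \<eta> where \<eta>: "\<eta> \<in> \<Theta>" "\<eta> \<le> \<theta>" "y < real n * llr b \<theta> \<eta> x" by blast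
    \<comment> \<open>The ratio splits as
      \<open>llr b \<theta> \<eta> z + llr b \<theta>\<^sub>s \<theta> z\<close>. Neither term
      increases with \<open>z\<close>, so they are bounded below by their values at \<open>x\<close>
      and at \<open>deriv b \<theta>\<close>.\<close>
    have "y + real n * ?\<kappa> \<le> real n * llr b \<theta>\<^sub>s \<eta> z" if "z \<le> x" for z
    proof -
      have "z \<le> deriv b \<theta>" using that xD by (auto simp: D_def)
      then have "(\<theta>\<^sub>s - \<theta>) * z \<le> (\<theta>\<^sub>s - \<theta>) * deriv b \<theta>" "(\<theta> - \<eta>) * z \<le> (\<theta> - \<eta>) * x"
        using \<theta> \<eta> that by (auto intro: mult_left_mono)
      then have "llr b \<theta> \<eta> x + ?\<kappa> \<le> llr b \<theta>\<^sub>s \<eta> z"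
        by (simp add: llr_def algebra_simps)
      then have "real n * (llr b \<theta> \<eta> x + ?\<kappa>) \<le> real n * llr b \<theta>\<^sub>s \<eta> z"
        by (rule mult_left_mono) simp
      then show ?thesis using \<eta>(3) by (simp add: algebra_simps)
    qed
    moreover have [measurable]: "llr b \<theta>\<^sub>s \<eta> \<in> borel_measurable borel"
      unfolding llr_def by measurable
    ultimately have "prob {\<omega> \<in> space M. ?X \<omega> \<le> x}
        \<le> prob {\<omega> \<in> space M. y + real n * ?\<kappa> \<le> real n * llr b \<theta>\<^sub>s \<eta> (?X \<omega>)}"
      by (intro finite_measure_mono) auto
    also have "\<dots> \<le> exp (- (y + real n * ?\<kappa>))"
      by (rule chernoff[OF i \<theta>s \<eta>(1) n])
    finally show ?thesis .
  qed
  show "prob {\<omega> \<in> space M. ?X \<omega> \<in> D} \<le> exp (- (y + real n * ?\<kappa>))"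
  proof (cases "D = {}")
    case False
    define s where "s = Sup D"
    have bdd: "bdd_above D" by (auto simp: D_def intro!: bdd_aboveI[of _ "deriv b \<theta>"])
    \<comment> \<open>Openness of \<open>D\<close> keeps its supremum out. The bound is known only
      for closed half-lines ending in \<open>D\<close>, and the left limit of the distribution
      function at \<open>s\<close> extends it to \<open>{..<s}\<close> without counting a possible
      atom at \<open>s\<close>.\<close>
    have "D \<subseteq> {..<s}"
    proof
      fix x assume x: "x \<in> D"
      then obtain e where "e > 0" "ball x e \<subseteq> D" using \<open>open D\<close> by (meson openE)
      then have "x + e / 2 \<in> D" by (auto simp: dist_real_def)
      then have "x + e / 2 \<le> s" unfolding s_def by (rule cSup_upper[OF _ bdd])
      with \<open>e > 0\<close> show "x \<in> {..<s}" by simp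
    qed
    interpret R: real_distribution "distr M borel ?X" by (rule real_distribution_distr) simp
    have "R.prob {..<s} \<le> exp (- (y + real n * ?\<kappa>))"
    proof (rule tendsto_upperbound[OF R.cdf_at_left])
      have "cdf (distr M borel ?X) z \<le> exp (- (y + real n * ?\<kappa>))" if zs: "z < s" for z
      proof -
        obtain x where x: "x \<in> D" "z < x"
          using zs False bdd unfolding s_def by (auto simp: less_cSup_iff)
        have "cdf (distr M borel ?X) z = prob {\<omega> \<in> space M. ?X \<omega> \<le> z}"
          unfolding cdf_def by (subst measure_distr) (auto intro!: arg_cong[where f = prob])
        also have "\<dots> \<le> prob {\<omega> \<in> space M. ?X \<omega> \<le> x}"
          using x by (intro finite_measure_mono) auto
        also note half_line[OF x(1)]
        finally show ?thesis .
      qed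
      then show "\<forall>\<^sub>F z in at_left s. cdf (distr M borel ?X) z \<le> exp (- (y + real n * ?\<kappa>))"
        by (auto simp: eventually_at_filter)
    qed simp
    moreover have "prob {\<omega> \<in> space M. ?X \<omega> \<in> D} \<le> R.prob {..<s}"
      using \<open>D \<subseteq> {..<s}\<close>
      by (subst measure_distr) (auto intro!: finite_measure_mono)
    ultimately show ?thesis by linarith
  qed simp
qed

section \<open>Bounds on the number of pulls at a finite horizon\<close>

text \<open>The decomposition on a single path. Random counters disappear by summing over all their
  possible values, which leaves events about samples of fixed size whose expectations can be taken
  separately.\<close>

lemma pulls_pointwise:
  assumes policy: "kl_ucb_policy \<Theta> b M K Y U g A"
    and arms: "i \<in> {1..K}" "a \<in> {1..K}"
    and in_Theta: "\<theta>\<^sub>a \<in> \<Theta>" "\<theta>\<^sub>r \<in> \<Theta>" "\<theta>' \<in> \<Theta>" "\<theta>\<^sub>q \<in> \<Theta>"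
    and less: "\<theta>\<^sub>a < \<theta>\<^sub>r" "\<theta>\<^sub>r < \<theta>'" "\<theta>' < \<theta>\<^sub>q"
    and \<Delta>: "\<Delta> = llr b \<theta>' \<theta>\<^sub>a (deriv b \<theta>\<^sub>r)" "\<Delta> > 0"
    and T: "K \<le> T" and g: "\<And>t. t \<in> {K..<T} \<Longrightarrow> 0 < g t \<and> g t \<le> G" and G: "1 \<le> G"
    and \<omega>: "\<omega> \<in> space M"
  defines "B \<equiv> \<lambda>t n. {x. x < deriv b \<theta>\<^sub>q \<and> (\<exists>\<eta>\<in>\<Theta>. ln (g t / real n) < real n * llr b \<theta>\<^sub>q \<eta> x)}"
  shows "real (pulls A a T \<omega>) \<le> 1
    + (\<Sum>t\<in>{K..<T}. \<Sum>n\<in>{1..t}. indicator {\<omega> \<in> space M. sample_mean Y i n \<omega> \<in> B t n} \<omega>)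
    + ln G / \<Delta>
    + (\<Sum>n\<in>{1..T}. indicator {\<omega> \<in> space M. deriv b \<theta>\<^sub>r \<le> sample_mean Y a n \<omega>} \<omega>)"
proof -
  \<comment> \<open>These two reasons are charged to the counter of arm \<open>a\<close>; every draw
    outside them is charged to a deviation of arm \<open>i\<close>.\<close>
  let ?P = "\<lambda>n. deriv b \<theta>\<^sub>r \<le> sample_mean Y a n \<omega> \<or> real n * \<Delta> \<le> ln G"
  have bij: "bij_betw (\<lambda>t. A t \<omega>) {1..K} {1..K}"
    and arg_max: "\<And>t. t \<ge> K \<Longrightarrow> is_arg_max
            (\<lambda>a. kl_ucb_index \<Theta> b (emp_mean Y A a t \<omega>) (pulls A a t \<omega>) (g t))
            (\<lambda>a. a \<in> {1..K}) (A (Suc t) \<omega>)"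
    using policy \<omega> unfolding kl_ucb_policy_def by blast+
  have one: "pulls A a' K \<omega> = 1" if "a' \<in> {1..K}" for a'
    using pulls_initial[where A = A and \<omega> = \<omega>, OF bij that] .
  have "real (pulls A a T \<omega>) \<le> real (1
    + (\<Sum>t\<in>{K..<T}. of_bool (A (Suc t) \<omega> = a \<and> \<not> ?P (pulls A a t \<omega>)))
    + (\<Sum>n\<in>{1..<pulls A a T \<omega>}. of_bool (?P n)))"
    unfolding of_nat_le_iff by (rule pulls_le_count[OF T one[OF arms(2)]])
  also have "\<dots> = 1
    + (\<Sum>t\<in>{K..<T}. of_bool (A (Suc t) \<omega> = a \<and> \<not> ?P (pulls A a t \<omega>)))
    + (\<Sum>n\<in>{1..<pulls A a T \<omega>}. of_bool (?P n))"
    by (simp only: of_nat_add of_nat_sum of_nat_of_bool of_nat_1)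
  also have "(\<Sum>t\<in>{K..<T}. of_bool (A (Suc t) \<omega> = a \<and> \<not> ?P (pulls A a t \<omega>)))
     \<le> (\<Sum>t\<in>{K..<T}. \<Sum>n\<in>{1..t}. indicat_real {\<omega> \<in> space M. sample_mean Y i n \<omega> \<in> B t n} \<omega>)"
  proof (rule sum_mono)
    fix t assume t: "t \<in> {K..<T}"
    let ?f = "\<lambda>n. indicat_real {\<omega> \<in> space M. sample_mean Y i n \<omega> \<in> B t n} \<omega>"
    show "of_bool (A (Suc t) \<omega> = a \<and> \<not> ?P (pulls A a t \<omega>)) \<le> (\<Sum>n\<in>{1..t}. ?f n)"
    proof (cases "A (Suc t) \<omega> = a \<and> \<not> ?P (pulls A a t \<omega>)")
      case True
      define n m where "n = pulls A i t \<omega>" and "m = pulls A a t \<omega>"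
      have n: "n \<in> {1..t}" and m: "0 < m"
        using pulls_mono[of K t A i \<omega>] pulls_mono[of K t A a \<omega>] one arms t
          pulls_le[of A i t \<omega>] by (auto simp: n_def m_def)
      have le: "kl_ucb_index \<Theta> b (sample_mean Y i n \<omega>) n (g t)
          \<le> kl_ucb_index \<Theta> b (sample_mean Y a m \<omega>) m (g t)"
        using arg_max[of t] t arms True
        by (auto simp: is_arg_max_linorder n_def m_def emp_mean_eq)
      \<comment> \<open>Otherwise the index of arm \<open>a\<close> reaches
        \<open>deriv b \<theta>\<^sub>q\<close> as well. Its sample mean is below
        \<open>deriv b \<theta>\<^sub>r\<close>, where the ratio towards
        \<open>\<theta>\<^sub>a\<close> is at least \<Delta>, and dropping the division by
        \<open>m\<close> in the exploration level gives \<open>real m * \<Delta> \<le> ln G\<close>,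
        contrary to the case.\<close>
      have "kl_ucb_index \<Theta> b (sample_mean Y i n \<omega>) n (g t) < ereal (deriv b \<theta>\<^sub>q)"
      proof (rule ccontr)
        assume "\<not> ?thesis"
        with le have ge: "ereal (deriv b \<theta>\<^sub>q) \<le> kl_ucb_index \<Theta> b (sample_mean Y a m \<omega>) m (g t)"
          by simp
        have r: "sample_mean Y a m \<omega> \<le> deriv b \<theta>\<^sub>r" using True by (simp add: m_def)
        also have "\<dots> \<le> deriv b \<theta>'" using deriv_b_less in_Theta less by (simp add: less_imp_le)
        finally have "real m * llr b \<theta>' \<theta>\<^sub>a (sample_mean Y a m \<omega>) \<le> ln (g t / real m)"
          using index_geD[OF in_Theta(4,3) less(3) m ge _ in_Theta(1)] by simp
        moreover have "(\<theta>' - \<theta>\<^sub>a) * sample_mean Y a m \<omega> \<le> (\<theta>' - \<theta>\<^sub>a) * deriv b \<theta>\<^sub>r"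
          using r less by (intro mult_left_mono) auto
        then have "\<Delta> \<le> llr b \<theta>' \<theta>\<^sub>a (sample_mean Y a m \<omega>)"
          by (simp add: \<Delta> llr_def algebra_simps)
        then have "real m * \<Delta> \<le> real m * llr b \<theta>' \<theta>\<^sub>a (sample_mean Y a m \<omega>)"
          by (rule mult_left_mono) simp
        moreover have "ln (g t / real m) \<le> ln G"
        proof (rule ln_mono)
          show "0 < g t / real m" using g[OF t] m by simp
          have "g t * 1 \<le> G * real m" using g[OF t] G m by (intro mult_mono) auto
          then show "g t / real m \<le> G" using m by (simp add: field_simps)
        qed
        ultimately have "real m * \<Delta> \<le> ln G" by linarith
        with True show False by (simp add: m_def)
      qed
      from index_lessD[OF in_Theta(4) _ this] n have "sample_mean Y i n \<omega> \<in> B t n"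
        by (auto simp: B_def)
      then have "1 \<le> ?f n" using \<omega> by simp
      also have "?f n \<le> (\<Sum>n\<in>{1..t}. ?f n)" using n by (intro member_le_sum) auto
      finally show ?thesis using True by simp
    qed (auto intro: sum_nonneg)
  qed
  also have "(\<Sum>n\<in>{1..<pulls A a T \<omega>}. of_bool (?P n)) \<le>
      (\<Sum>n\<in>{1..T}. of_bool (real n * \<Delta> \<le> ln G)
         + indicat_real {\<omega> \<in> space M. deriv b \<theta>\<^sub>r \<le> sample_mean Y a n \<omega>} \<omega>)"
  proof (rule order_trans[OF sum_mono2 sum_mono])
    show "{1..<pulls A a T \<omega>} \<subseteq> {1..T}" using pulls_le[of A a T \<omega>] by auto
  qed (use \<omega> in \<open>auto simp: indicator_def\<close>)
  also have "\<dots> = (\<Sum>n\<in>{1..T}. of_bool (real n * \<Delta> \<le> ln G))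
      + (\<Sum>n\<in>{1..T}. indicat_real {\<omega> \<in> space M. deriv b \<theta>\<^sub>r \<le> sample_mean Y a n \<omega>} \<omega>)"
    by (rule sum.distrib)
  also have "(\<Sum>n\<in>{1..T}. of_bool (real n * \<Delta> \<le> ln G)) \<le> ln G / \<Delta>"
  proof -
    have "(\<Sum>n\<in>{1..T}. of_bool (real n * \<Delta> \<le> ln G)) = real (card {n \<in> {1..T}. real n * \<Delta> \<le> ln G})"
      by (simp add: of_bool_def sum.If_cases Int_def)
    also have "card {n \<in> {1..T}. real n * \<Delta> \<le> ln G} \<le> card {1..nat \<lfloor>ln G / \<Delta>\<rfloor>}"
      using \<Delta>(2) by (intro card_mono) (auto simp: le_nat_floor pos_le_divide_eq)
    then have "real (card {n \<in> {1..T}. real n * \<Delta> \<le> ln G}) \<le> real (nat \<lfloor>ln G / \<Delta>\<rfloor>)"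
      by simp
    also have "\<dots> \<le> ln G / \<Delta>" using G \<Delta>(2) by (intro of_nat_floor) simp
    finally show ?thesis .
  qed
  finally show ?thesis by simp
qed

text \<open>The division by the counter in the exploration level costs a factor \<open>n\<close> in
  the deviation probability of arm \<open>i\<close>. The geometric factor gained from the gap
  between \<open>\<theta>\<^sub>q\<close> and \<open>\<theta>\<^sub>s\<close> absorbs it.\<close>

lemma expected_pulls_le:
  assumes policy: "kl_ucb_policy \<Theta> b M K Y U g A"
    and arms: "i \<in> {1..K}" "a \<in> {1..K}"
    and means: "\<mu> i = deriv b \<theta>\<^sub>s" "\<mu> a = deriv b \<theta>\<^sub>a"
    and in_Theta: "\<theta>\<^sub>a \<in> \<Theta>" "\<theta>\<^sub>r \<in> \<Theta>" "\<theta>' \<in> \<Theta>" "\<theta>\<^sub>q \<in> \<Theta>" "\<theta>\<^sub>s \<in> \<Theta>"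
    and less: "\<theta>\<^sub>a < \<theta>\<^sub>r" "\<theta>\<^sub>r < \<theta>'" "\<theta>' < \<theta>\<^sub>q" "\<theta>\<^sub>q < \<theta>\<^sub>s"
    and \<Delta>: "\<Delta> = llr b \<theta>' \<theta>\<^sub>a (deriv b \<theta>\<^sub>r)" "\<Delta> > 0"
    and T: "K \<le> T" and g: "\<And>t. t \<in> {K..<T} \<Longrightarrow> 0 < g t \<and> g t \<le> G" and G: "1 \<le> G"
  shows "expectation (\<lambda>\<omega>. real (pulls A a T \<omega>)) \<le> 1
    + (\<Sum>t\<in>{K..<T}. \<Sum>n\<in>{1..t}. real n * exp (- llr b \<theta>\<^sub>s \<theta>\<^sub>q (deriv b \<theta>\<^sub>q)) ^ n / g t)
    + ln G / \<Delta>
    + (\<Sum>n\<in>{1..T}. exp (- llr b \<theta>\<^sub>a \<theta>\<^sub>r (deriv b \<theta>\<^sub>r)) ^ n)"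
proof -
  define B where
    "B t n = {x. x < deriv b \<theta>\<^sub>q \<and> (\<exists>\<eta>\<in>\<Theta>. ln (g t / real n) < real n * llr b \<theta>\<^sub>q \<eta> x)}" for t n
  let ?E = "\<lambda>t n. {\<omega> \<in> space M. sample_mean Y i n \<omega> \<in> B t n}"
  let ?F = "\<lambda>n. {\<omega> \<in> space M. deriv b \<theta>\<^sub>r \<le> sample_mean Y a n \<omega>}"
  let ?f = "\<lambda>\<omega>. 1 + (\<Sum>t\<in>{K..<T}. \<Sum>n\<in>{1..t}. indicat_real (?E t n) \<omega>)
    + ln G / \<Delta> + (\<Sum>n\<in>{1..T}. indicat_real (?F n) \<omega>)"
  have [measurable]: "sample_mean Y i n \<in> borel_measurable M" "sample_mean Y a n \<in> borel_measurable M" for n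
    using arms by measurable
  have E: "?E t n \<in> events"
    and prob_E: "0 < g t \<Longrightarrow> prob (?E t n)
      \<le> real n * exp (- llr b \<theta>\<^sub>s \<theta>\<^sub>q (deriv b \<theta>\<^sub>q)) ^ n / g t" if "0 < n" for t n
  proof -
    note dev = lower_deviation[OF arms(1) in_Theta(5) means(1) in_Theta(4) less(4) that,
        where y = "ln (g t / real n)", folded B_def]
    have [measurable]: "B t n \<in> sets borel" by (rule dev(1))
    show "?E t n \<in> events" by measurable
    assume "0 < g t"
    with that have "exp (- ln (g t / real n)) = real n / g t"
      by (simp add: exp_minus)
    moreover have "exp (- (ln (g t / real n) + real n * l)) = exp (- ln (g t / real n)) * exp (- l) ^ n" for l
      by (simp add: exp_of_nat_mult[symmetric] exp_add[symmetric])
    ultimately have "exp (- (ln (g t / real n) + real n * l)) = real n * exp (- l) ^ n / g t" for l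
      by simp
    with dev(2) show "prob (?E t n) \<le> real n * exp (- llr b \<theta>\<^sub>s \<theta>\<^sub>q (deriv b \<theta>\<^sub>q)) ^ n / g t"
      by simp
  qed
  have F: "?F n \<in> events" for n by measurable
  have prob_F: "prob (?F n) \<le> exp (- llr b \<theta>\<^sub>a \<theta>\<^sub>r (deriv b \<theta>\<^sub>r)) ^ n" if "0 < n" for n
  proof -
    \<comment> \<open>Since \<open>\<theta>\<^sub>a < \<theta>\<^sub>r\<close>, the ratio increases
      with the sample mean.\<close>
    have "?F n \<subseteq> {\<omega> \<in> space M. real n * llr b \<theta>\<^sub>a \<theta>\<^sub>r (deriv b \<theta>\<^sub>r)
        \<le> real n * llr b \<theta>\<^sub>a \<theta>\<^sub>r (sample_mean Y a n \<omega>)}"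
      using less by (auto simp: llr_def intro!: mult_left_mono)
    moreover have [measurable]: "llr b \<theta>\<^sub>a \<theta>\<^sub>r \<in> borel_measurable borel"
      unfolding llr_def by measurable
    ultimately have "prob (?F n) \<le> prob {\<omega> \<in> space M. real n * llr b \<theta>\<^sub>a \<theta>\<^sub>r (deriv b \<theta>\<^sub>r)
        \<le> real n * llr b \<theta>\<^sub>a \<theta>\<^sub>r (sample_mean Y a n \<omega>)}"
      by (intro finite_measure_mono) auto
    also have "\<dots> \<le> exp (- (real n * llr b \<theta>\<^sub>a \<theta>\<^sub>r (deriv b \<theta>\<^sub>r)))"
      by (rule chernoff[OF arms(2) in_Theta(1) means(2) in_Theta(2) that])
    finally show ?thesis by (simp add: exp_of_nat_mult[symmetric])
  qed
  have int: "integrable M ?f"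
    using E F by (intro Bochner_Integration.integrable_add Bochner_Integration.integrable_sum)
      (auto simp: emeasure_eq_measure)
  have "expectation (\<lambda>\<omega>. real (pulls A a T \<omega>)) \<le> expectation ?f"
  proof (rule integral_mono'[OF int])
    show "real (pulls A a T \<omega>) \<le> ?f \<omega>" if "\<omega> \<in> space M" for \<omega>
      unfolding B_def
      by (rule pulls_pointwise[OF policy arms in_Theta(1-4) less(1-3) \<Delta> T g G that])
    then show "0 \<le> ?f \<omega>" if "\<omega> \<in> space M" for \<omega>
      using that by (meson of_nat_0_le_iff order_trans)
  qed
  also have "expectation ?f = 1 + (\<Sum>t\<in>{K..<T}. \<Sum>n\<in>{1..t}. prob (?E t n))
    + ln G / \<Delta> + (\<Sum>n\<in>{1..T}. prob (?F n))"
  proof -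
    have intE: "integrable M (indicat_real (?E t n))" if "n \<in> {1..t}" for t n
      using E that by (auto simp: emeasure_eq_measure)
    have intF: "integrable M (indicat_real (?F n))" for n
      using F by (auto simp: emeasure_eq_measure)
    have "expectation (\<lambda>\<omega>. \<Sum>t\<in>{K..<T}. \<Sum>n\<in>{1..t}. indicat_real (?E t n) \<omega>)
        = (\<Sum>t\<in>{K..<T}. \<Sum>n\<in>{1..t}. prob (?E t n))"
    proof (subst Bochner_Integration.integral_sum)
      show "(\<Sum>t\<in>{K..<T}. expectation (\<lambda>\<omega>. \<Sum>n\<in>{1..t}. indicat_real (?E t n) \<omega>))
          = (\<Sum>t\<in>{K..<T}. \<Sum>n\<in>{1..t}. prob (?E t n))"
        by (intro sum.cong refl, subst Bochner_Integration.integral_sum)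
          (use intE E in \<open>auto intro!: sum.cong\<close>)
    qed (use intE in \<open>intro Bochner_Integration.integrable_sum, auto\<close>)
    moreover have "expectation (\<lambda>\<omega>. \<Sum>n\<in>{1..T}. indicat_real (?F n) \<omega>) = (\<Sum>n\<in>{1..T}. prob (?F n))"
      using intF F by (simp add: Bochner_Integration.integral_sum)
    moreover have "integrable M (\<lambda>\<omega>. \<Sum>t\<in>{K..<T}. \<Sum>n\<in>{1..t}. indicat_real (?E t n) \<omega>)"
      using intE by (intro Bochner_Integration.integrable_sum) auto
    moreover have "integrable M (\<lambda>\<omega>. \<Sum>n\<in>{1..T}. indicat_real (?F n) \<omega>)"
      using intF by (intro Bochner_Integration.integrable_sum) auto
    ultimately show ?thesis by (simp add: prob_space)
  qed
  also have "\<dots> \<le> 1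
    + (\<Sum>t\<in>{K..<T}. \<Sum>n\<in>{1..t}. real n * exp (- llr b \<theta>\<^sub>s \<theta>\<^sub>q (deriv b \<theta>\<^sub>q)) ^ n / g t)
    + ln G / \<Delta> + (\<Sum>n\<in>{1..T}. exp (- llr b \<theta>\<^sub>a \<theta>\<^sub>r (deriv b \<theta>\<^sub>r)) ^ n)"
    using prob_E prob_F g by (intro add_mono sum_mono order_refl) auto
  finally show ?thesis .
qed

text \<open>The auxiliary parameters are fixed from the two arms and \<epsilon> alone. Hence
  \<Delta> and \<open>C\<close> are the same for all policies, levels and horizons, as is required
  when the policy changes with the horizon.\<close>

lemma expected_pulls_le_log:
  assumes arms: "i \<in> {1..K}" "a \<in> {1..K}" "\<mu> a < \<mu> i"
    and \<epsilon>: "\<epsilon> > 0"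
  obtains \<Delta> C where "0 < \<Delta>" "kl_mean \<xi> \<Theta> b (\<mu> a) (\<mu> i) < (1 + \<epsilon>) * \<Delta>"
    "0 < kl_mean \<xi> \<Theta> b (\<mu> a) (\<mu> i)" "0 \<le> C"
    "\<And>g A T G. \<lbrakk>kl_ucb_policy \<Theta> b M K Y U g A; K \<le> T; 1 \<le> G;
        \<And>t. t \<in> {K..<T} \<Longrightarrow> 0 < g t \<and> g t \<le> G\<rbrakk> \<Longrightarrow>
      expectation (\<lambda>\<omega>. real (pulls A a T \<omega>)) \<le> ln G / \<Delta> + C * (1 + (\<Sum>t\<in>{K..<T}. 1 / g t))"
proof -
  obtain \<theta>\<^sub>s where s: "\<theta>\<^sub>s \<in> \<Theta>" "\<mu> i = deriv b \<theta>\<^sub>s" using means arms by (meson mean_spaceE)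
  obtain \<theta>\<^sub>a where a: "\<theta>\<^sub>a \<in> \<Theta>" "\<mu> a = deriv b \<theta>\<^sub>a" using means arms by (meson mean_spaceE)
  have as: "\<theta>\<^sub>a < \<theta>\<^sub>s" using arms s a by (simp add: deriv_b_less_iff)
  define d where "d = llr b \<theta>\<^sub>s \<theta>\<^sub>a (deriv b \<theta>\<^sub>a)"
  have d: "d > 0" unfolding d_def using llr_deriv_b_pos s a as by simp
  have d_eq: "kl_mean \<xi> \<Theta> b (\<mu> a) (\<mu> i) = d" using s a by (simp add: d_def kl_mean_deriv_b)
  \<comment> \<open>Exceeding \<open>d'\<close> is exactly what \<Delta> has to satisfy. Continuity
    is used twice: first \<theta>' is moved close to \<open>\<theta>\<^sub>s\<close> with the mean
    kept at \<open>deriv b \<theta>\<^sub>a\<close>, then \<open>\<theta>\<^sub>r\<close> close to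
    \<open>\<theta>\<^sub>a\<close> with \<theta>' kept.\<close>
  define d' where "d' = d / (1 + \<epsilon>)"
  have d': "d' < d" "d' > 0" using d \<epsilon> by (auto simp: d'_def field_simps)
  have cont: "isCont b \<theta>" "isCont (deriv b) \<theta>" if "\<theta> \<in> \<Theta>" for \<theta>
    using b_differentiable[OF that] b_twice_differentiable[OF that]
    by (auto intro: differentiable_imp_continuous_within)
  have "((\<lambda>\<theta>. llr b \<theta> \<theta>\<^sub>a (deriv b \<theta>\<^sub>a)) \<longlongrightarrow> d) (at \<theta>\<^sub>s within {..<\<theta>\<^sub>s})"
    unfolding d_def llr_def using cont[OF s(1)]
    by (intro tendsto_intros) (auto simp: isCont_def intro: tendsto_within_subset)
  then have "\<forall>\<^sub>F \<theta> in at_left \<theta>\<^sub>s. d' < llr b \<theta> \<theta>\<^sub>a (deriv b \<theta>\<^sub>a)"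
    using d' by (simp add: order_tendsto_iff)
  then have "\<forall>\<^sub>F \<theta> in at_left \<theta>\<^sub>s. \<theta> \<in> {\<theta>\<^sub>a<..<\<theta>\<^sub>s} \<and> d' < llr b \<theta> \<theta>\<^sub>a (deriv b \<theta>\<^sub>a)"
    using eventually_at_left_real[OF as] by (rule eventually_conj[rotated])
  then obtain \<theta>' where \<theta>': "\<theta>\<^sub>a < \<theta>'" "\<theta>' < \<theta>\<^sub>s" "d' < llr b \<theta>' \<theta>\<^sub>a (deriv b \<theta>\<^sub>a)"
    using eventually_happens'[OF trivial_limit_at_left_real] by auto
  have "((\<lambda>\<theta>. llr b \<theta>' \<theta>\<^sub>a (deriv b \<theta>)) \<longlongrightarrow> llr b \<theta>' \<theta>\<^sub>a (deriv b \<theta>\<^sub>a)) (at \<theta>\<^sub>a within {\<theta>\<^sub>a<..})"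
    unfolding llr_def using cont[OF a(1)]
    by (intro tendsto_intros) (auto simp: isCont_def intro: tendsto_within_subset)
  then have "\<forall>\<^sub>F \<theta> in at_right \<theta>\<^sub>a. d' < llr b \<theta>' \<theta>\<^sub>a (deriv b \<theta>)"
    using \<theta>'(3) by (simp add: order_tendsto_iff)
  then have "\<forall>\<^sub>F \<theta> in at_right \<theta>\<^sub>a. \<theta> \<in> {\<theta>\<^sub>a<..<\<theta>'} \<and> d' < llr b \<theta>' \<theta>\<^sub>a (deriv b \<theta>)"
    using eventually_at_right_real[OF \<theta>'(1)] by (rule eventually_conj[rotated])
  then obtain \<theta>\<^sub>r where r: "\<theta>\<^sub>a < \<theta>\<^sub>r" "\<theta>\<^sub>r < \<theta>'" "d' < llr b \<theta>' \<theta>\<^sub>a (deriv b \<theta>\<^sub>r)"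
    using eventually_happens'[OF trivial_limit_at_right_real] by auto
  obtain \<theta>\<^sub>q where q: "\<theta>' < \<theta>\<^sub>q" "\<theta>\<^sub>q < \<theta>\<^sub>s" using dense[OF \<theta>'(2)] by blast
  have in_Theta: "\<theta>' \<in> \<Theta>" "\<theta>\<^sub>r \<in> \<Theta>" "\<theta>\<^sub>q \<in> \<Theta>"
    using Theta_between[OF a(1) s(1)] \<theta>' r q by auto
  define \<Delta> where "\<Delta> = llr b \<theta>' \<theta>\<^sub>a (deriv b \<theta>\<^sub>r)"
  have \<Delta>: "\<Delta> > 0" "d < (1 + \<epsilon>) * \<Delta>"
  proof -
    show "\<Delta> > 0" using r d' unfolding \<Delta>_def by linarith
    have "d = (1 + \<epsilon>) * d'" using \<epsilon> by (simp add: d'_def)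
    also have "\<dots> < (1 + \<epsilon>) * \<Delta>" using r(3) \<epsilon> unfolding \<Delta>_def by simp
    finally show "d < (1 + \<epsilon>) * \<Delta>" .
  qed
  define x where "x = exp (- llr b \<theta>\<^sub>s \<theta>\<^sub>q (deriv b \<theta>\<^sub>q))"
  define z where "z = exp (- llr b \<theta>\<^sub>a \<theta>\<^sub>r (deriv b \<theta>\<^sub>r))"
  have x: "0 < x" "x < 1" and z: "0 < z" "z < 1"
    using llr_deriv_b_pos s a q r in_Theta by (auto simp: x_def z_def)
  define C1 where "C1 = (\<Sum>n. z ^ n)"
  \<comment> \<open>The weight \<open>Suc n\<close> instead of \<open>n\<close> matches the
    differentiated geometric series.\<close>
  define C2 where "C2 = (\<Sum>n. real (Suc n) * x ^ n)"
  have sm1: "summable (\<lambda>n. z ^ n)" and sm2: "summable (\<lambda>n. real (Suc n) * x ^ n)"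
    using x z geometric_deriv_sums[of x] by (auto simp: sums_iff)
  have C1: "(\<Sum>n\<in>{1..T}. z ^ n) \<le> C1" for T
    unfolding C1_def using z by (intro sum_le_suminf sm1) auto
  have C2: "(\<Sum>n\<in>{1..t}. real n * x ^ n) \<le> C2" for t
  proof -
    have "(\<Sum>n\<in>{1..t}. real n * x ^ n) \<le> (\<Sum>n\<in>{1..t}. real (Suc n) * x ^ n)"
      using x by (intro sum_mono mult_right_mono) auto
    also have "\<dots> \<le> C2"
      unfolding C2_def using x by (intro sum_le_suminf sm2) auto
    finally show ?thesis .
  qed
  have nonneg: "0 \<le> C1" "0 \<le> C2" using C1[of 0] C2[of 0] by simp_all
  show thesis
  proof (rule that[of \<Delta> "1 + C1 + C2"])
    fix g A T G
    assume policy: "kl_ucb_policy \<Theta> b M K Y U g A" and T: "K \<le> T" and G: "(1::real) \<le> G"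
      and g: "\<And>t. t \<in> {K..<T} \<Longrightarrow> 0 < g t \<and> g t \<le> G"
    have "expectation (\<lambda>\<omega>. real (pulls A a T \<omega>)) \<le> 1
      + (\<Sum>t\<in>{K..<T}. \<Sum>n\<in>{1..t}. real n * x ^ n / g t) + ln G / \<Delta> + (\<Sum>n\<in>{1..T}. z ^ n)"
      unfolding x_def z_def
      by (rule expected_pulls_le[OF policy arms(1,2) s(2) a(2) a(1) in_Theta(2,1,3) s(1)
            r(1,2) q \<Delta>_def \<Delta>(1) T g G])
    also have "(\<Sum>t\<in>{K..<T}. \<Sum>n\<in>{1..t}. real n * x ^ n / g t) \<le> (\<Sum>t\<in>{K..<T}. C2 * (1 / g t))"
    proof (rule sum_mono)
      fix t assume t: "t \<in> {K..<T}"
      have "(\<Sum>n\<in>{1..t}. real n * x ^ n / g t) = (\<Sum>n\<in>{1..t}. real n * x ^ n) / g t"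
        by (simp add: sum_divide_distrib)
      also have "\<dots> \<le> C2 / g t" using C2 g[OF t] by (intro divide_right_mono) auto
      finally show "(\<Sum>n\<in>{1..t}. real n * x ^ n / g t) \<le> C2 * (1 / g t)" by simp
    qed
    also have "\<dots> = C2 * (\<Sum>t\<in>{K..<T}. 1 / g t)" by (rule sum_distrib_left[symmetric])
    also have "\<dots> \<le> (1 + C1 + C2) * (\<Sum>t\<in>{K..<T}. 1 / g t)"
      using nonneg g by (intro mult_right_mono sum_nonneg) (auto intro: less_imp_le)
    also note C1[of T]
    finally show "expectation (\<lambda>\<omega>. real (pulls A a T \<omega>))
        \<le> ln G / \<Delta> + (1 + C1 + C2) * (1 + (\<Sum>t\<in>{K..<T}. 1 / g t))"
      using nonneg by (simp add: algebra_simps)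
  qed (use \<Delta> d d_eq nonneg in auto)
qed

end

section \<open>Asymptotics in the horizon\<close>

text \<open>A telescoping comparison with \<open>1 / ln (t - 1) - 1 / ln t\<close>. From 3 on,
  \<open>ln t\<close> is at least 1, so the exponent can be lowered to 2, and
  \<open>ln (t - 1)\<close> is positive.\<close>

lemma sum_inverse_log_le:
  assumes c: "2 \<le> c"
  shows "(\<Sum>t\<in>{3..<T}. 1 / (real t * ln (real t) powr c)) \<le> 1 / ln 2"
proof -
  \<comment> \<open>The maximum makes the right side 0 as long as the sum is empty.\<close>
  have "(\<Sum>t\<in>{3..<T}. 1 / (real t * ln (real t) powr c)) \<le> 1 / ln 2 - 1 / ln (real (max 3 T - 1))"
  proof (induction T)
    case (Suc T)
    show ?case
    proof (cases "3 \<le> T")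
      case False
      then have "{3..<Suc T} = {}" "max 3 (Suc T) - 1 = 2" by auto
      then show ?thesis by simp
    next
      case True
      define l m where "l = ln (real T)" and "m = ln (real T - 1)"
      have "exp 1 \<le> real T" using exp_le True by (meson numeral_le_real_of_nat_iff order_trans)
      then have l: "1 \<le> l" unfolding l_def using True by (subst ln_ge_iff) auto
      have m: "0 < m" "m \<le> l" using True by (auto simp: l_def m_def)
      have "m - l = ln ((real T - 1) / real T)"
        using True by (simp add: l_def m_def ln_div)
      also have "\<dots> \<le> (real T - 1) / real T - 1"
        using True by (intro ln_le_minus_one) auto
      also have "\<dots> = - (1 / real T)" using True by (simp add: field_simps)
      finally have diff: "1 / real T \<le> l - m" by simp
      have "l ^ 2 \<le> l powr c"
        using l c powr_mono[of 2 c l] by simp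
      then have "1 / (real T * l powr c) \<le> 1 / (real T * l ^ 2)"
        using True l by (intro divide_left_mono mult_left_mono mult_pos_pos) auto
      also have "\<dots> \<le> (l - m) / l ^ 2"
        using diff l by (simp add: field_simps)
      also have "\<dots> \<le> (l - m) / (l * m)"
        using l m by (intro divide_left_mono) (auto simp: power2_eq_square)
      also have "\<dots> = 1 / m - 1 / l"
        using l m by (simp add: field_simps)
      finally have "1 / (real T * l powr c) \<le> 1 / m - 1 / l" .
      moreover have "(\<Sum>t\<in>{3..<T}. 1 / (real t * ln (real t) powr c)) \<le> 1 / ln 2 - 1 / m"
        using Suc True by (simp add: max_def m_def of_nat_diff)
      moreover have "max 3 (Suc T) - 1 = T" using True by simp
      ultimately show ?thesis using True by (simp add: l_def)
    qed
  qed simp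
  moreover have "0 \<le> 1 / ln (real (max 3 T - 1))" by simp
  ultimately show ?thesis by linarith
qed

text \<open>The strict inequality leaves a positive multiple of \<open>ln T\<close> to spare, which
  outgrows the iterated logarithm from \<open>ln T powr c\<close> and every constant.\<close>

lemma eventually_log_bound:
  fixes C \<Delta> \<epsilon> d c :: real
  assumes "0 < \<Delta>" "0 < d" "0 < \<epsilon>" "d < (1 + \<epsilon>) * \<Delta>"
  shows "\<forall>\<^sub>F T::nat in sequentially.
    ln (real T * ln (real T) powr c) / \<Delta> + C \<le> (1 + \<epsilon>) / d * ln (real T)"
proof -
  define \<delta> where "\<delta> = (1 + \<epsilon>) / d - 1 / \<Delta>"
  have \<delta>: "\<delta> > 0" using assms by (simp add: \<delta>_def field_simps)
  have "\<forall>\<^sub>F T::nat in sequentially. ln (real T * ln (real T) powr c) = ln (real T) + c * ln (ln (real T))"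
    using eventually_gt_at_top[of 2]
    by eventually_elim (simp add: ln_mult ln_powr)
  moreover have "\<forall>\<^sub>F T::nat in sequentially. c / \<Delta> * ln (ln (real T)) + C \<le> \<delta> * ln (real T)"
    using \<delta> by real_asymp
  ultimately show ?thesis
    by eventually_elim (simp add: \<delta>_def algebra_simps add_divide_distrib)
qed

theorem theorem8:
  fixes \<Theta> :: "real set" and \<xi> :: "real measure" and b :: "real \<Rightarrow> real"
    and M :: "'w measure" and K :: nat and \<mu> :: "nat \<Rightarrow> real"
    and Y :: "nat \<Rightarrow> nat \<Rightarrow> 'w \<Rightarrow> real" and U :: "'w \<Rightarrow> real" and c \<mu>_star :: real
  assumes bandit: "expfam_bandit \<Theta> \<xi> b M K \<mu> Y U"
    and c: "c \<ge> 7"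
    and mu_star: "\<mu>_star = Max (\<mu> ` {1..K})"
  shows
    "(\<forall>A :: nat \<Rightarrow> 'w \<Rightarrow> nat. kl_ucb_plus \<Theta> b M K Y U c A \<longrightarrow>
        (\<forall>\<epsilon>>0. \<forall>a\<in>{1..K}. \<mu> a < \<mu>_star \<longrightarrow>
          (\<exists>r \<in> O(\<lambda>T::nat. sqrt (ln (real T))). \<forall>\<^sub>F T in sequentially.
             (LINT \<omega>|M. real (pulls A a T \<omega>))
               \<le> (1 + \<epsilon>) / kl_mean \<xi> \<Theta> b (\<mu> a) \<mu>_star * ln (real T) + r T)))
     \<and>
     (\<forall>A :: nat \<Rightarrow> nat \<Rightarrow> 'w \<Rightarrow> nat. (\<forall>T\<ge>K. kl_ucb_H_plus \<Theta> b M K Y U c T (A T)) \<longrightarrow>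
        (\<forall>\<epsilon>>0. \<forall>a\<in>{1..K}. \<mu> a < \<mu>_star \<longrightarrow>
          (\<exists>r \<in> O(\<lambda>T::nat. sqrt (ln (real T))). \<forall>\<^sub>F T in sequentially.
             (LINT \<omega>|M. real (pulls (A T) a T \<omega>))
               \<le> (1 + \<epsilon>) / kl_mean \<xi> \<Theta> b (\<mu> a) \<mu>_star * ln (real T) + r T)))"
proof -
  interpret expfam_bandit \<Theta> \<xi> b M K \<mu> Y U by (rule bandit)
  have "Max (\<mu> ` {1..K}) \<in> \<mu> ` {1..K}" using K_ge_2 by (intro Max_in) auto
  then obtain i where i: "i \<in> {1..K}" "\<mu> i = \<mu>_star" using mu_star by auto
  let ?g = "\<lambda>t::nat. real t * ln (real t) powr c"
  have g_pos: "0 < ?g t" if "2 \<le> t" for t using that by simp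
  have g_mono: "?g s \<le> ?g t" if "2 \<le> s" "s \<le> t" for s t
    using that c by (intro mult_mono powr_mono2) auto
  have ln_ge_1: "1 \<le> ln (real t)" if "3 \<le> t" for t :: nat
    using that exp_le by (subst ln_ge_iff) (auto intro: order_trans[of _ 3])
  have g_ge_1: "1 \<le> ?g t" if "3 \<le> t" for t
  proof -
    have "1 * 1 \<le> ?g t" using that c ln_ge_1[OF that] by (intro mult_mono ge_one_powr_ge_zero) auto
    then show ?thesis by simp
  qed
  \<comment> \<open>Both policies are instances: policy and level may depend on the horizon,
    provided the level stays below \<open>?g T\<close> and its reciprocals have a bounded
    sum.\<close>
  have pulls_bound: "\<forall>\<^sub>F T in sequentially. expectation (\<lambda>\<omega>. real (pulls (A T) a T \<omega>))
      \<le> (1 + \<epsilon>) / kl_mean \<xi> \<Theta> b (\<mu> a) \<mu>_star * ln (real T)"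
    if a: "a \<in> {1..K}" "\<mu> a < \<mu>_star" and \<epsilon>: "0 < \<epsilon>"
      and policy: "\<And>T. K \<le> T \<Longrightarrow> kl_ucb_policy \<Theta> b M K Y U (g T) (A T)"
      and g: "\<And>T t. 3 \<le> T \<Longrightarrow> t \<in> {K..<T} \<Longrightarrow> 0 < g T t \<and> g T t \<le> ?g T"
      and S: "\<And>T. 3 \<le> T \<Longrightarrow> (\<Sum>t\<in>{K..<T}. 1 / g T t) \<le> S"
    for A g a S and \<epsilon> :: real
  proof -
    from i a have "\<mu> a < \<mu> i" by simp
    from expected_pulls_le_log[OF i(1) a(1) this \<epsilon>] obtain \<Delta> C
      where \<Delta>: "0 < \<Delta>" "kl_mean \<xi> \<Theta> b (\<mu> a) \<mu>_star < (1 + \<epsilon>) * \<Delta>"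
        "0 < kl_mean \<xi> \<Theta> b (\<mu> a) \<mu>_star" "0 \<le> C"
        and bound: "\<And>g A T G. \<lbrakk>kl_ucb_policy \<Theta> b M K Y U g A; K \<le> T; 1 \<le> G;
          \<And>t. t \<in> {K..<T} \<Longrightarrow> 0 < g t \<and> g t \<le> G\<rbrakk> \<Longrightarrow>
          expectation (\<lambda>\<omega>. real (pulls A a T \<omega>)) \<le> ln G / \<Delta> + C * (1 + (\<Sum>t\<in>{K..<T}. 1 / g t))"
      unfolding i(2) by blast
    show ?thesis
      using eventually_log_bound[OF \<Delta>(1,3) \<epsilon> \<Delta>(2), of c "C * (1 + S)"]
        eventually_ge_at_top[of K] eventually_ge_at_top[of 3]
    proof eventually_elim
      case (elim T)
      have "expectation (\<lambda>\<omega>. real (pulls (A T) a T \<omega>))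
          \<le> ln (?g T) / \<Delta> + C * (1 + (\<Sum>t\<in>{K..<T}. 1 / g T t))"
        by (rule bound[OF policy[OF elim(2)] elim(2) g_ge_1[OF elim(3)] g[OF elim(3)]])
      also have "\<dots> \<le> ln (?g T) / \<Delta> + C * (1 + S)"
        using S[OF elim(3)] \<Delta>(4) by (intro add_mono mult_left_mono order_refl)
      also note elim(1)
      finally show ?case .
    qed
  qed
  show ?thesis
  proof (intro conjI allI impI ballI)
    fix A and \<epsilon> :: real and a
    assume A: "kl_ucb_plus \<Theta> b M K Y U c A" and a: "0 < \<epsilon>" "a \<in> {1..K}" "\<mu> a < \<mu>_star"
    have "(\<Sum>t\<in>{K..<T}. 1 / ?g t) \<le> 1 / ?g 2 + 1 / ln 2" for T
    proof -
      \<comment> \<open>\<open>K\<close> may be 2, whereas the series bound starts at 3, so the term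
        at 2 is split off.\<close>
      have "(\<Sum>t\<in>{K..<T}. 1 / ?g t) \<le> (\<Sum>t\<in>{2} \<union> {3..<T}. 1 / ?g t)"
        using K_ge_2 by (intro sum_mono2) auto
      also have "\<dots> = 1 / ?g 2 + (\<Sum>t\<in>{3..<T}. 1 / ?g t)" by simp
      finally show ?thesis using sum_inverse_log_le[of c T] c by linarith
    qed
    then have "\<forall>\<^sub>F T in sequentially. expectation (\<lambda>\<omega>. real (pulls A a T \<omega>))
      \<le> (1 + \<epsilon>) / kl_mean \<xi> \<Theta> b (\<mu> a) \<mu>_star * ln (real T)"
      using pulls_bound[of a \<epsilon> "\<lambda>_. ?g" "\<lambda>_. A" "1 / ?g 2 + 1 / ln 2"] a A K_ge_2 g_pos g_mono
      by (simp add: kl_ucb_plus_def)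
    \<comment> \<open>The margin given by \<epsilon> has already absorbed all lower-order terms, so
      the remainder can be 0.\<close>
    then show "\<exists>r \<in> O(\<lambda>T::nat. sqrt (ln (real T))). \<forall>\<^sub>F T in sequentially.
             expectation (\<lambda>\<omega>. real (pulls A a T \<omega>))
               \<le> (1 + \<epsilon>) / kl_mean \<xi> \<Theta> b (\<mu> a) \<mu>_star * ln (real T) + r T"
      by (intro bexI[of _ "\<lambda>_. 0"]) auto
  next
    fix A and \<epsilon> :: real and a
    assume A: "\<forall>T\<ge>K. kl_ucb_H_plus \<Theta> b M K Y U c T (A T)"
      and a: "0 < \<epsilon>" "a \<in> {1..K}" "\<mu> a < \<mu>_star"
    \<comment> \<open>The level is constant in \<open>t\<close>: at most \<open>T\<close> terms are
      added, each at most \<open>1 / T\<close>.\<close>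
    have "(\<Sum>t\<in>{K..<T}. 1 / ?g T) \<le> 1" if T: "3 \<le> T" for T
    proof -
      have "1 \<le> ln (real T) powr c" using c ln_ge_1[OF T] by (intro ge_one_powr_ge_zero) auto
      then have "real T * 1 \<le> ?g T" by (intro mult_left_mono) auto
      then have "real (T - K) \<le> ?g T" by (simp add: of_nat_diff_if)
      then show ?thesis using g_pos[of T] T by (simp add: field_simps)
    qed
    then have "\<forall>\<^sub>F T in sequentially. expectation (\<lambda>\<omega>. real (pulls (A T) a T \<omega>))
      \<le> (1 + \<epsilon>) / kl_mean \<xi> \<Theta> b (\<mu> a) \<mu>_star * ln (real T)"
      using pulls_bound[of a \<epsilon> "\<lambda>T _. ?g T" A 1] a A g_pos
      by (simp add: kl_ucb_H_plus_def)
    then show "\<exists>r \<in> O(\<lambda>T::nat. sqrt (ln (real T))). \<forall>\<^sub>F T in sequentially.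
             expectation (\<lambda>\<omega>. real (pulls (A T) a T \<omega>))
               \<le> (1 + \<epsilon>) / kl_mean \<xi> \<Theta> b (\<mu> a) \<mu>_star * ln (real T) + r T"
      by (intro bexI[of _ "\<lambda>_. 0"]) auto
  qed
qed

end
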